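(* Let $S_n$ be the star with $n$ edges and let $D_k(S_n)\subset U_k^{top}(S_n)$ be the space of regular $k$-point configurations in $S_n$. Then $D_k(S_n)$ is a deformation retract of $U_k^{top}(S_n)$.
   Context: The star $S_n$ is the graph on $n+1$ vertices with one vertex $v_0$ of degree $n$ and $n$ vertices $v_1,\dots,v_n$ of degree one. It carries the metric $d(x,y)=\kappa\rho(x,y)$, where $\rho$ is the standard simplicial metric on $S_n$ (every edge has length one) and $\kappa$ is a fixed constant with $\kappa\ge k-1$; thus $d(v_0,v_i)=\kappa$ for $i>0$ and $d(v_i,v_j)=2\kappa$ for $1\le i<j\le n$. The unordered $k$-point configuration space of a space $X$ is $U_k^{top}(X)=\{c\subset X: |c|=k\}$, with the quotient topology from $X^k-\Delta(X)$ under $(x_1,\dots,x_k)\mapsto\{x_1,\dots,x_k\}$, where $\Delta(X)$ is the fat diagonal, the set of $k$-tuples with $x_i=x_j$ for some $i\ne j$. For $x,y\in S_n$, $[x,y]$ denotes the geodesic segment joining them. A finite subset $c\subset S_n$ is a chain if $|c\cap[x,y]|=1+d(x,y)$ for all $x,y\in c$. For $c\subset S_n$ put $A_i(c)=c\cap[v_0,v_i]$ ($1\le i\le n$); the nonempty sets $A_i(c)$ are called the arms of $c$. A configuration $c$ is regular if there is an arm $A_m(c)$, called a governing arm, such that $A_m(c)\cup A_i(c)$ is a chain for all $i$, and there are at least two arms of $c$. Finally $D_k(S_n)=\{c\in U_k^{top}(S_n): c\text{ is regular}\}$.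
   Formalization: The number of edges n is at least 2, the number of points k is at least 1 and κ is positive; for n = 1 or k = 0 no configuration has two arms, so D_k is empty while U_k is not. Arms are counted by index, which matters only for k = 1. *)

theory Defs
  imports "HOL-Analysis.Analysis"
begin

section \<open>Geodesic segments, quotient topologies, deformation retracts\<close>

definition geodesic_path :: "'a set \<Rightarrow> ('a \<Rightarrow> 'a \<Rightarrow> real) \<Rightarrow> 'a \<Rightarrow> 'a \<Rightarrow> (real \<Rightarrow> 'a) \<Rightarrow> bool" where
  "geodesic_path M d x y \<gamma> \<longleftrightarrow>
     \<gamma> ` {0..d x y} \<subseteq> M \<and> \<gamma> 0 = x \<and> \<gamma> (d x y) = y \<and>
     (\<forall>s\<in>{0..d x y}. \<forall>t\<in>{0..d x y}. d (\<gamma> s) (\<gamma> t) = \<bar>s - t\<bar>)"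

lemma geodesic_path_dist:
  assumes \<gamma>: "geodesic_path M d x y \<gamma>" and s: "s \<in> {0..d x y}"
  shows "\<gamma> s \<in> M" "d x (\<gamma> s) = s" "d (\<gamma> s) y = d x y - s"
proof -
  have 0: "0 \<in> {0..d x y}" and L: "d x y \<in> {0..d x y}"
    using s by auto
  have \<gamma>': "\<gamma> 0 = x" "\<gamma> (d x y) = y"
    "\<And>s t. s \<in> {0..d x y} \<Longrightarrow> t \<in> {0..d x y} \<Longrightarrow> d (\<gamma> s) (\<gamma> t) = \<bar>s - t\<bar>"
    using \<gamma> unfolding geodesic_path_def by blast+
  show "\<gamma> s \<in> M"
    using \<gamma> s by (auto simp: geodesic_path_def)
  show "d x (\<gamma> s) = s"
    using \<gamma>'(3)[OF 0 s] s unfolding \<gamma>'(1) by simp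
  show "d (\<gamma> s) y = d x y - s"
    using \<gamma>'(3)[OF s L] s unfolding \<gamma>'(2) by simp
qed

text \<open>The union is used so that the term is meaningful without a uniqueness proof; in the star
  all geodesics from \<open>x\<close> to \<open>y\<close> have the same image (\<open>star_segment_unique\<close> below).\<close>

definition geodesic_segment :: "'a set \<Rightarrow> ('a \<Rightarrow> 'a \<Rightarrow> real) \<Rightarrow> 'a \<Rightarrow> 'a \<Rightarrow> 'a set" where
  "geodesic_segment M d x y = (\<Union>\<gamma>\<in>{\<gamma>. geodesic_path M d x y \<gamma>}. \<gamma> ` {0..d x y})"

definition quotient_topology :: "'a topology \<Rightarrow> ('a \<Rightarrow> 'b) \<Rightarrow> 'b topology" where
  "quotient_topology X f =
     topology (\<lambda>U. U \<subseteq> f ` topspace X \<and> openin X {x \<in> topspace X. f x \<in> U})"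

lemma openin_quotient_topology:
  "openin (quotient_topology X f) U \<longleftrightarrow>
     U \<subseteq> f ` topspace X \<and> openin X {x \<in> topspace X. f x \<in> U}"
proof -
  have 1: "{x \<in> topspace X. f x \<in> S \<inter> T} =
      {x \<in> topspace X. f x \<in> S} \<inter> {x \<in> topspace X. f x \<in> T}" for S T by auto
  have 2: "{x \<in> topspace X. f x \<in> \<Union>\<K>} = (\<Union>K\<in>\<K>. {x \<in> topspace X. f x \<in> K})" for \<K> by auto
  have "istopology (\<lambda>U. U \<subseteq> f ` topspace X \<and> openin X {x \<in> topspace X. f x \<in> U})"
    unfolding istopology_def
  proof (intro conjI allI impI)
    fix \<K> assume "\<forall>K\<in>\<K>. K \<subseteq> f ` topspace X \<and> openin X {x \<in> topspace X. f x \<in> K}"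
    then show "openin X {x \<in> topspace X. f x \<in> \<Union>\<K>}"
      unfolding 2 by (intro openin_Union) auto
  qed (auto simp: 1 simp del: Int_iff)
  then show ?thesis
    by (simp add: quotient_topology_def)
qed

lemma topspace_quotient_topology [simp]:
  "topspace (quotient_topology X f) = f ` topspace X"
proof (rule antisym)
  show "topspace (quotient_topology X f) \<subseteq> f ` topspace X"
    using openin_topspace[of "quotient_topology X f"] unfolding openin_quotient_topology by simp
  have "{x \<in> topspace X. f x \<in> f ` topspace X} = topspace X" by auto
  then have "openin (quotient_topology X f) (f ` topspace X)"
    by (simp add: openin_quotient_topology)
  then show "f ` topspace X \<subseteq> topspace (quotient_topology X f)"
    by (rule openin_subset)
qed

lemma quotient_map_quotient_topology: "quotient_map X (quotient_topology X f) f"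
  by (auto simp: quotient_map_def openin_quotient_topology)

text \<open>The deformation fixes \<open>A\<close> pointwise at all times (a strong deformation retract);
  the library's \<open>deformation_retract_of_space\<close> is the version with \<open>\<lambda>_. True\<close>.\<close>

definition is_deformation_retract_of :: "'a set \<Rightarrow> 'a topology \<Rightarrow> bool" where
  "is_deformation_retract_of A X \<longleftrightarrow>
     A \<subseteq> topspace X \<and>
     (\<exists>r. homotopic_with (\<lambda>f. \<forall>a\<in>A. f a = a) X X id r \<and>
          retraction_maps X (subtopology X A) r id)"


section \<open>Configuration spaces\<close>

definition fat_diagonal :: "'a topology \<Rightarrow> nat \<Rightarrow> (nat \<Rightarrow> 'a) set" where
  "fat_diagonal X k =
     {x \<in> {..<k} \<rightarrow>\<^sub>E topspace X. \<exists>i<k. \<exists>j<k. i \<noteq> j \<and> x i = x j}"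

definition ordered_conf :: "'a topology \<Rightarrow> nat \<Rightarrow> (nat \<Rightarrow> 'a) topology" where
  "ordered_conf X k =
     subtopology (product_topology (\<lambda>_. X) {..<k})
       (({..<k} \<rightarrow>\<^sub>E topspace X) - fat_diagonal X k)"

definition unordered_conf :: "'a topology \<Rightarrow> nat \<Rightarrow> 'a set topology" where
  "unordered_conf X k = quotient_topology (ordered_conf X k) (\<lambda>x. x ` {..<k})"

lemma topspace_ordered_conf:
  "topspace (ordered_conf X k) = {x \<in> {..<k} \<rightarrow>\<^sub>E topspace X. inj_on x {..<k}}"
  by (auto simp: ordered_conf_def fat_diagonal_def inj_on_def)

lemma topspace_unordered_conf:
  "topspace (unordered_conf X k) = {c. c \<subseteq> topspace X \<and> finite c \<and> card c = k}"
proof (intro equalityI subsetI)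
  fix c assume "c \<in> {c. c \<subseteq> topspace X \<and> finite c \<and> card c = k}"
  then have c: "c \<subseteq> topspace X" "finite c" "card c = k" by auto
  then obtain f where f: "bij_betw f {..<k} c"
    using ex_bij_betw_nat_finite[of c] by (auto simp: atLeast0LessThan)
  let ?x = "restrict f {..<k}"
  have "?x \<in> topspace (ordered_conf X k)"
    using f c by (auto simp: topspace_ordered_conf bij_betw_def inj_on_def)
  moreover have "?x ` {..<k} = c"
    using f by (auto simp: bij_betw_def)
  ultimately show "c \<in> topspace (unordered_conf X k)"
    unfolding unordered_conf_def topspace_quotient_topology by blast
qed (auto simp: unordered_conf_def topspace_ordered_conf card_image PiE_iff)


section \<open>The star\<close>

text \<open>\<open>(i, t)\<close> is the point of the \<open>i\<close>-th edge at simplicial distance \<open>t\<close> from the centre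
  \<open>(0, 0)\<close>.  The second components are nonnegative; the absolute values in the distance formula
  only make it nonnegative outside the star, as \<open>Metric_space\<close> requires.\<close>

type_synonym star_point = "nat \<times> real"

definition star :: "nat \<Rightarrow> star_point set" where
  "star n = insert (0, 0) ({1..n} \<times> {0<..1})"

definition star_vertex :: "nat \<Rightarrow> star_point" where
  "star_vertex i = (if i = 0 then (0, 0) else (i, 1))"

definition star_simplicial_dist :: "star_point \<Rightarrow> star_point \<Rightarrow> real" where
  "star_simplicial_dist x y =
     (if fst x = fst y then \<bar>snd x - snd y\<bar> else \<bar>snd x\<bar> + \<bar>snd y\<bar>)"

definition star_dist :: "real \<Rightarrow> star_point \<Rightarrow> star_point \<Rightarrow> real" where
  "star_dist \<kappa> x y = \<kappa> * star_simplicial_dist x y"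

lemma star_dist_vertices:
  "0 < i \<Longrightarrow> star_dist \<kappa> (star_vertex 0) (star_vertex i) = \<kappa>"
  "0 < i \<Longrightarrow> i < j \<Longrightarrow> star_dist \<kappa> (star_vertex i) (star_vertex j) = 2 * \<kappa>"
  by (auto simp: star_dist_def star_simplicial_dist_def star_vertex_def)

lemma Metric_space_star:
  assumes "0 < \<kappa>"
  shows "Metric_space (star n) (star_dist \<kappa>)"
proof
  fix x y z :: star_point
  show "0 \<le> star_dist \<kappa> x y"
    using assms by (simp add: star_dist_def star_simplicial_dist_def)
  show "star_dist \<kappa> x y = star_dist \<kappa> y x"
    by (auto simp: star_dist_def star_simplicial_dist_def)
  assume "x \<in> star n" "y \<in> star n"
  then show "star_dist \<kappa> x y = 0 \<longleftrightarrow> x = y"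
    using assms by (auto simp: star_dist_def star_simplicial_dist_def star_def)
  assume "z \<in> star n"
  have "star_simplicial_dist x z \<le> star_simplicial_dist x y + star_simplicial_dist y z"
    by (auto simp: star_simplicial_dist_def)
  then show "star_dist \<kappa> x z \<le> star_dist \<kappa> x y + star_dist \<kappa> y z"
    using assms by (simp add: star_dist_def flip: distrib_left)
qed

definition star_topology :: "nat \<Rightarrow> real \<Rightarrow> star_point topology" where
  "star_topology n \<kappa> = Metric_space.mtopology (star n) (star_dist \<kappa>)"

definition star_segment :: "nat \<Rightarrow> real \<Rightarrow> star_point \<Rightarrow> star_point \<Rightarrow> star_point set" where
  "star_segment n \<kappa> x y = geodesic_segment (star n) (star_dist \<kappa>) x y"

lemma star_coords: "x \<in> star n \<Longrightarrow> 0 \<le> snd x \<and> (fst x = 0 \<longleftrightarrow> snd x = 0)"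
  by (auto simp: star_def)

lemma star_segment_superset:
  assumes \<kappa>: "0 < \<kappa>" and xyz: "x \<in> star n" "y \<in> star n" "z \<in> star n"
    and eq: "star_dist \<kappa> x z + star_dist \<kappa> z y = star_dist \<kappa> x y"
    and \<gamma>: "geodesic_path (star n) (star_dist \<kappa>) x y \<gamma>"
  shows "z \<in> \<gamma> ` {0..star_dist \<kappa> x y}"
proof -
  let ?d = "star_dist \<kappa>" and ?r = star_simplicial_dist
  interpret Metric_space "star n" ?d by (rule Metric_space_star [OF \<kappa>])
  define w where "w = \<gamma> (?d x z)"
  have s: "?d x z \<in> {0..?d x y}"
    using eq nonneg[of x z] nonneg[of z y] unfolding atLeastAtMost_iff by linarith
  then have w: "w \<in> star n" and "?d x w = ?d x z" "?d w y = ?d z y"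
    using geodesic_path_dist[OF \<gamma> s] eq by (auto simp: w_def)
  then have "?r x w = ?r x z" "?r w y = ?r z y" "?r x z + ?r z y = ?r x y"
    using \<kappa> eq by (auto simp: star_dist_def simp flip: distrib_left)
  then have "w = z"
    using star_coords[OF xyz(1)] star_coords[OF xyz(2)] star_coords[OF xyz(3)] star_coords[OF w]
    unfolding star_simplicial_dist_def prod_eq_iff by (smt (verit))
  then show ?thesis
    using s unfolding w_def by (rule image_eqI[OF sym])
qed

lemma star_geodesic_path_exists:
  assumes \<kappa>: "0 < \<kappa>" and xy: "x \<in> star n" "y \<in> star n"
  shows "\<exists>\<gamma>. geodesic_path (star n) (star_dist \<kappa>) x y \<gamma>"
proof -
  obtain i a j b where x: "x = (i, a)" and y: "y = (j, b)" by force
  have i: "i \<le> n" "0 \<le> a" "a \<le> 1" "i = 0 \<longleftrightarrow> a = 0"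
   and j: "j \<le> n" "0 \<le> b" "b \<le> 1" "j = 0 \<longleftrightarrow> b = 0"
    using xy by (auto simp: star_def x y)
  define pt where "pt = (\<lambda>(m::nat) (t::real). if t = 0 then (0, 0) else (m, t))"
  define \<gamma> where "\<gamma> = (\<lambda>s. if i = j then pt i (a + sgn (b - a) * (s / \<kappa>))
      else if s / \<kappa> \<le> a then pt i (a - s / \<kappa>) else pt j (s / \<kappa> - a))"
  have pt: "pt m t \<in> star n" if "m \<le> n" "0 \<le> t" "t \<le> 1" "m = 0 \<longrightarrow> t = 0" for m t
    using that by (auto simp: pt_def star_def)
  have same: "star_simplicial_dist (pt m t) (pt m u) = \<bar>t - u\<bar>" if "0 \<le> t" "0 \<le> u" for m t u
    using that by (auto simp: pt_def star_simplicial_dist_def)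
  have diff: "star_simplicial_dist (pt m t) (pt l u) = t + u"
      "star_simplicial_dist (pt l u) (pt m t) = t + u"
    if "0 \<le> t" "0 \<le> u" "m \<noteq> l" for m t l u
    using that by (auto simp: pt_def star_simplicial_dist_def)
  define R where "R = star_simplicial_dist x y"
  have R: "R = (if i = j then \<bar>a - b\<bar> else a + b)"
    using i j by (simp add: R_def x y star_simplicial_dist_def)
  have D: "star_dist \<kappa> x y = \<kappa> * R"
    by (simp add: star_dist_def R_def)
  have scale: "0 \<le> s / \<kappa> \<and> s / \<kappa> \<le> R" if "s \<in> {0..\<kappa> * R}" for s
    using that \<kappa> by (auto simp: field_simps)
  have range: "0 \<le> a + sgn (b - a) * u \<and> a + sgn (b - a) * u \<le> 1"
    if "i = j" "0 \<le> u" "u \<le> R" for u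
    using that i j by (auto simp: R sgn_if)
  have in_star: "\<gamma> s \<in> star n" if "s \<in> {0..\<kappa> * R}" for s
    unfolding \<gamma>_def using scale[OF that] i j range[of "s / \<kappa>"]
    by (auto intro!: pt simp: R)
  have ends: "\<gamma> 0 = x" "\<gamma> (\<kappa> * R) = y"
    using \<kappa> i j by (auto simp: \<gamma>_def x y R pt_def sgn_if)
  have isom: "star_dist \<kappa> (\<gamma> s) (\<gamma> t) = \<bar>s - t\<bar>"
    if st: "s \<in> {0..\<kappa> * R}" "t \<in> {0..\<kappa> * R}" for s t
  proof -
    let ?u = "s / \<kappa>" and ?v = "t / \<kappa>"
    have u: "0 \<le> ?u" "?u \<le> R" and v: "0 \<le> ?v" "?v \<le> R"
      using scale st by auto
    have "star_simplicial_dist (\<gamma> s) (\<gamma> t) = \<bar>?u - ?v\<bar>"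
    proof (cases "i = j")
      case True
      have "star_simplicial_dist (\<gamma> s) (\<gamma> t)
          = \<bar>(a + sgn (b - a) * ?u) - (a + sgn (b - a) * ?v)\<bar>"
        using True range[OF True u] range[OF True v]
        unfolding \<gamma>_def if_P[OF True] by (intro same) auto
      also have "\<dots> = \<bar>?u - ?v\<bar>"
        using True u v R by (auto simp: sgn_if)
      finally show ?thesis .
    next
      case False
      then show ?thesis
        by (auto simp: \<gamma>_def same diff)
    qed
    then show ?thesis
      using \<kappa> by (simp add: star_dist_def flip: diff_divide_distrib)
  qed
  show ?thesis
    unfolding geodesic_path_def D
    by (intro exI[of _ \<gamma>] conjI ballI image_subsetI in_star ends isom)
qed

lemma star_segment_unique:
  assumes "0 < \<kappa>" "x \<in> star n" "y \<in> star n"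
    and "geodesic_path (star n) (star_dist \<kappa>) x y \<gamma>"
  shows "star_segment n \<kappa> x y = \<gamma> ` {0..star_dist \<kappa> x y}"
    and "star_segment n \<kappa> x y =
      {z \<in> star n. star_dist \<kappa> x z + star_dist \<kappa> z y = star_dist \<kappa> x y}"
proof -
  let ?I = "{z \<in> star n. star_dist \<kappa> x z + star_dist \<kappa> z y = star_dist \<kappa> x y}"
  have sub: "\<beta> ` {0..star_dist \<kappa> x y} \<subseteq> ?I"
    if \<beta>: "geodesic_path (star n) (star_dist \<kappa>) x y \<beta>" for \<beta>
  proof (rule image_subsetI)
    fix s assume s: "s \<in> {0..star_dist \<kappa> x y}"
    show "\<beta> s \<in> ?I"
      using geodesic_path_dist[OF \<beta> s] by simp
  qed
  have sup: "?I \<subseteq> \<beta> ` {0..star_dist \<kappa> x y}"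
    if "geodesic_path (star n) (star_dist \<kappa>) x y \<beta>" for \<beta>
    using star_segment_superset[OF assms(1-3) _ _ that] by blast
  have all: "\<beta> ` {0..star_dist \<kappa> x y} = ?I"
    if "geodesic_path (star n) (star_dist \<kappa>) x y \<beta>" for \<beta>
    using sub[OF that] sup[OF that] by (rule antisym)
  show "star_segment n \<kappa> x y = ?I"
    unfolding star_segment_def geodesic_segment_def using all assms(4) by blast
  then show "star_segment n \<kappa> x y = \<gamma> ` {0..star_dist \<kappa> x y}"
    using all[OF assms(4)] by simp
qed

lemma star_segment_eq:
  assumes "0 < \<kappa>" "x \<in> star n" "y \<in> star n"
  shows "star_segment n \<kappa> x y =
    {z \<in> star n. star_dist \<kappa> x z + star_dist \<kappa> z y = star_dist \<kappa> x y}"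
  using star_geodesic_path_exists[OF assms] star_segment_unique(2)[OF assms] by blast


section \<open>Regular configurations\<close>

definition chain :: "nat \<Rightarrow> real \<Rightarrow> star_point set \<Rightarrow> bool" where
  "chain n \<kappa> c \<longleftrightarrow> finite c \<and> c \<subseteq> star n \<and>
     (\<forall>x\<in>c. \<forall>y\<in>c. real (card (c \<inter> star_segment n \<kappa> x y)) = 1 + star_dist \<kappa> x y)"

definition arm :: "nat \<Rightarrow> real \<Rightarrow> nat \<Rightarrow> star_point set \<Rightarrow> star_point set" where
  "arm n \<kappa> i c = c \<inter> star_segment n \<kappa> (star_vertex 0) (star_vertex i)"

text \<open>Arms are counted by index: a configuration containing the centre has \<open>n\<close> arms.  For \<open>n \<ge> 2\<close>,
  having at least two arms then differs from having at least two distinct nonempty sets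
  \<open>arm n \<kappa> i c\<close> only for the one-point configuration at the centre.\<close>

definition regular :: "nat \<Rightarrow> real \<Rightarrow> star_point set \<Rightarrow> bool" where
  "regular n \<kappa> c \<longleftrightarrow>
     (\<exists>m\<in>{1..n}. arm n \<kappa> m c \<noteq> {} \<and> (\<forall>i\<in>{1..n}. chain n \<kappa> (arm n \<kappa> m c \<union> arm n \<kappa> i c))) \<and>
     2 \<le> card {i \<in> {1..n}. arm n \<kappa> i c \<noteq> {}}"

definition star_conf :: "nat \<Rightarrow> real \<Rightarrow> nat \<Rightarrow> star_point set topology" where
  "star_conf n \<kappa> k = unordered_conf (star_topology n \<kappa>) k"

definition regular_conf :: "nat \<Rightarrow> real \<Rightarrow> nat \<Rightarrow> star_point set set" where
  "regular_conf n \<kappa> k = {c \<in> topspace (star_conf n \<kappa> k). regular n \<kappa> c}"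

end

(*
Every point of a configuration c slides at constant speed along its own arm, from its distance
to v0 (measured by d) to the target s_i + l, where i is its arm and l is the number of points of
c below it on that arm.  The starting positions s_i depend on the ratios of the distances q_i of
the lowest points of the arms: s_m = t and s_i = 1 - t for i different from m, for some m and
some 0 <= t < 1.  Hence the final configuration is regular (v0 becomes occupied when t = 0), and
if c is regular then s_i = q_i, so that nothing moves.  Order along the arms is preserved, so no
two points collide.  The centre counts as an arm of its own, with number 0 and q_0 = 0.

The only danger to continuity is a point passing through v0 from one arm to another: when it is
on arm b, it adds one to l for all other points of arm b.  But as q_b tends to 0, s_b tends to 0
and s_i tends to 1 for i different from b, so all targets converge to those of the configuration
containing v0.  Continuity is checked on ordered configurations; the homotopy descends because
the quotient map stays a quotient map after taking the product with [0,1].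
*)
theory Submission
  imports Defs
begin

section \<open>Starting positions\<close>

text \<open>With \<open>w i j = (q j - q i) / (q i + q j)\<close>, \<open>gap w I i\<close> is the lead of the arm \<open>i\<close> if it is the
  unique arm with the lowest first point, and \<open>0\<close> otherwise; transposing \<open>w\<close> gives the same for the
  highest first point.\<close>

definition gap :: "('a \<Rightarrow> 'a \<Rightarrow> real) \<Rightarrow> 'a set \<Rightarrow> 'a \<Rightarrow> real" where
  "gap w I i = Min (insert 1 ((\<lambda>j. max 0 (w i j)) ` (I - {i})))"

lemma gap_le_one: "finite I \<Longrightarrow> gap w I i \<le> 1"
  by (simp add: gap_def)

lemma gap_le: "finite I \<Longrightarrow> j \<in> I \<Longrightarrow> j \<noteq> i \<Longrightarrow> gap w I i \<le> max 0 (w i j)"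
  unfolding gap_def by (rule Min_le) auto

lemma le_gap: "finite I \<Longrightarrow> x \<le> 1 \<Longrightarrow> (\<And>j. j \<in> I \<Longrightarrow> j \<noteq> i \<Longrightarrow> x \<le> max 0 (w i j)) \<Longrightarrow> x \<le> gap w I i"
  by (auto simp: gap_def)

lemma gap_nonneg: "finite I \<Longrightarrow> 0 \<le> gap w I i"
  by (rule le_gap) auto

lemma gap_singleton: "gap w {i} i = 1"
  by (simp add: gap_def)

text \<open>Two arms cannot both lead, since \<open>w i j\<close> and \<open>w j i\<close> are never
  both positive. The sum over \<open>I\<close> thus picks out the only possible nonzero gap, and
  \<open>start\<close> can refer to the leader without a choice that could jump.\<close>

lemma gap_peak:
  assumes I: "finite I" "I \<noteq> {}" and anti: "\<And>i j. w i j = - w j i"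
  obtains m where "m \<in> I" "gap w I m = sum (gap w I) I" "\<And>i. i \<in> I \<Longrightarrow> i \<noteq> m \<Longrightarrow> gap w I i = 0"
proof -
  have uniq: "gap w I i = 0 \<or> gap w I j = 0" if "i \<in> I" "j \<in> I" "i \<noteq> j" for i j
    using gap_le[OF I(1), of i j w] gap_le[OF I(1), of j i w] anti[of i j] that
      gap_nonneg[OF I(1), of w i] gap_nonneg[OF I(1), of w j] by force
  obtain m where m: "m \<in> I" "\<And>i. i \<in> I \<Longrightarrow> i \<noteq> m \<Longrightarrow> gap w I i = 0"
    using uniq I(2) by (metis ex_in_conv)
  have "sum (gap w I) I = gap w I m"
    using m I(1) by (simp add: sum.remove)
  then show ?thesis using that m by simp
qed

text \<open>\<open>A\<close> and \<open>B\<close> are the leads of the lowest and of the highest first point.  The sign of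
  \<open>2 * A - max A B\<close> decides which of the two arms governs.  This combination equals \<open>A\<close> if \<open>B = 0\<close>,
  \<open>- B\<close> if \<open>A = 0\<close>, \<open>A\<close> if \<open>A = B\<close> (always so for two arms), and \<open>1\<close> if \<open>A = 1\<close>: the first three
  cases make regular configurations fixed, the last one gives continuity at the centre.\<close>

definition start :: "('a \<Rightarrow> 'a \<Rightarrow> real) \<Rightarrow> 'a set \<Rightarrow> 'a \<Rightarrow> real" where
  "start w I i =
     (let A = sum (gap w I) I; B = sum (gap (\<lambda>i j. w j i) I) I
      in (1 + 2 * A - max A B) / 2 - max 0 (2 * gap w I i - max A B)
         + max 0 (gap (\<lambda>i j. w j i) I i - 2 * A))"

lemma start_singleton: "start w {i} i = 0"
  by (simp add: start_def gap_singleton)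

text \<open>Normal form, with \<open>m\<close> and \<open>p\<close> carrying the only possible
  nonzero gaps of the lowest and the highest first point. Arm \<open>m\<close> governs if
  \<open>0 \<le> E\<close>, otherwise \<open>p\<close> does; the governing arm starts at
  \<open>(1 - E) / 2\<close> and all others at \<open>(1 + E) / 2\<close>.\<close>

lemma start_shape:
  assumes I: "finite I" "I \<noteq> {}" and anti: "\<And>i j. w i j = - w j i"
  obtains m p A B E where "m \<in> I" "p \<in> I" "gap w I m = A" "gap (\<lambda>i j. w j i) I p = B"
    "0 \<le> A" "A \<le> 1" "0 \<le> B" "B \<le> 1"
    "\<forall>i\<in>I. i \<noteq> m \<longrightarrow> gap w I i = 0"
    "E = 2 * A - max A B"
    "\<forall>i\<in>I. start w I i = (1 + E) / 2 - (if i = m then max 0 E else 0) + (if i = p then max 0 (- E) else 0)"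
proof -
  obtain m where m: "m \<in> I" "gap w I m = sum (gap w I) I" "\<And>i. i \<in> I \<Longrightarrow> i \<noteq> m \<Longrightarrow> gap w I i = 0"
    by (rule gap_peak[where w = w, OF I anti]) (rule that; blast)
  obtain p where p: "p \<in> I" "gap (\<lambda>i j. w j i) I p = sum (gap (\<lambda>i j. w j i) I) I"
    "\<And>i. i \<in> I \<Longrightarrow> i \<noteq> p \<Longrightarrow> gap (\<lambda>i j. w j i) I i = 0"
    by (rule gap_peak[where w = "\<lambda>i j. w j i", OF I anti]) (rule that; blast)
  have bounds: "0 \<le> gap w I m" "gap w I m \<le> 1"
    "0 \<le> gap (\<lambda>i j. w j i) I p" "gap (\<lambda>i j. w j i) I p \<le> 1"
    using I(1) by (simp_all add: gap_nonneg gap_le_one)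
  define E where "E = 2 * gap w I m - max (gap w I m) (gap (\<lambda>i j. w j i) I p)"
  have st: "start w I i = (1 + E) / 2 - (if i = m then max 0 E else 0) + (if i = p then max 0 (- E) else 0)"
    if "i \<in> I" for i
  proof -
    have "gap w I i = (if i = m then gap w I m else 0)"
      "gap (\<lambda>i j. w j i) I i = (if i = p then gap (\<lambda>i j. w j i) I p else 0)"
      using m(3)[OF that] p(3)[OF that] by auto
    then have "start w I i = (1 + E) / 2 - max 0 ((if i = m then 2 * gap w I m else 0) - max (gap w I m) (gap (\<lambda>i j. w j i) I p))
        + max 0 ((if i = p then gap (\<lambda>i j. w j i) I p else 0) - 2 * gap w I m)"
      unfolding start_def Let_def m(2)[symmetric] p(2)[symmetric] E_def by (simp add: add_diff_eq)
    moreover have "max 0 ((if i = m then 2 * gap w I m else 0) - max (gap w I m) (gap (\<lambda>i j. w j i) I p))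
        = (if i = m then max 0 E else 0)"
      using bounds by (auto simp: E_def max_def)
    moreover have "max 0 ((if i = p then gap (\<lambda>i j. w j i) I p else 0) - 2 * gap w I m)
        = (if i = p then max 0 (- E) else 0)"
      using bounds by (auto simp: E_def max_def)
    ultimately show ?thesis by simp
  qed
  show ?thesis
    using that[OF m(1) p(1) refl refl bounds _ E_def] m(3) st by blast
qed

text \<open>Only \<open>E = -1\<close>, that is \<open>A = 0\<close> and \<open>B = 1\<close>, could
  push the governing start up to \<open>1\<close> and so put all other arms at \<open>0\<close>
  together. The assumption \<open>one\<close>, that at most one arm has a lead of \<open>1\<close>
  or more, excludes this.\<close>

lemma start_governed:
  assumes I: "finite I" "I \<noteq> {}" and anti: "\<And>i j. w i j = - w j i"
    and one: "\<And>i j i' j'. \<lbrakk>i \<in> I; j \<in> I; i' \<in> I; j' \<in> I; 1 \<le> w i j; 1 \<le> w i' j'\<rbrakk> \<Longrightarrow> i = i'"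
  obtains m where "m \<in> I" "0 \<le> start w I m" "start w I m < 1"
    "\<And>i. i \<in> I \<Longrightarrow> i \<noteq> m \<Longrightarrow> start w I i = 1 - start w I m"
proof (cases "\<exists>i. I = {i}")
  case True
  then obtain i where "I = {i}" by blast
  then show ?thesis using that[of i] by (auto simp: start_singleton)
next
  case False
  obtain m p A B E where mp: "m \<in> I" "p \<in> I" and gm: "gap w I m = A" and gp: "gap (\<lambda>i j. w j i) I p = B"
    and AB: "0 \<le> A" "A \<le> 1" "0 \<le> B" "B \<le> 1"
    and zm0: "\<forall>i\<in>I. i \<noteq> m \<longrightarrow> gap w I i = 0"
    and E: "E = 2 * A - max A B"
    and st0: "\<forall>i\<in>I. start w I i = (1 + E) / 2 - (if i = m then max 0 E else 0) + (if i = p then max 0 (- E) else 0)"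
    by (rule start_shape[where w = w, OF I anti]) (rule that; assumption)
  note zm = zm0[rule_format] and st = st0[rule_format]
  show ?thesis
  proof (cases "0 \<le> E")
    case True
    have "start w I i = (if i = m then (1 - E) / 2 else (1 + E) / 2)" if "i \<in> I" for i
      using st[OF that] True by (auto simp: field_simps)
    moreover have "E \<le> 1" using E AB by simp
    ultimately show ?thesis
      using True mp(1) by (intro that[of m]) (simp_all add: field_simps)
  next
    case neg: False
    have "\<not> (A = 0 \<and> B = 1)"
    proof
      assume *: "A = 0 \<and> B = 1"
      \<comment> \<open>\<open>B = 1\<close> makes every other arm lead \<open>p\<close> by at least
        \<open>1\<close>. By \<open>one\<close> there is just one such arm, and its gap is then
        \<open>1\<close>, against \<open>A = 0\<close>.\<close>
      have far: "1 \<le> w j p" if "j \<in> I" "j \<noteq> p" for j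
        using gap_le[OF I(1) that, of "\<lambda>i j. w j i"] gp * by (simp split: if_splits)
      obtain j where j: "j \<in> I" "j \<noteq> p" using False mp(2) by blast
      have "gap w I j \<ge> 1"
      proof (rule le_gap[OF I(1)])
        fix i assume "i \<in> I" "i \<noteq> j"
        then have "i = p" using one[OF j(1) mp(2) _ mp(2) far[OF j] far] by blast
        then show "1 \<le> max 0 (w j i)" using far[OF j] by simp
      qed simp
      then show False using zm[OF j(1)] gm * by (cases "j = m") auto
    qed
    moreover have mx: "max 0 E = 0" "max 0 (- E) = - E" using neg by auto
    have "start w I i = (if i = p then (1 - E) / 2 else (1 + E) / 2)" if "i \<in> I" for i
      unfolding st[OF that] mx by (simp add: field_simps)
    moreover have "-1 < E" if "\<not> (A = 0 \<and> B = 1)"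
      using E AB that by (auto simp: max_def)
    ultimately show ?thesis
      using neg mp(2) by (intro that[of p]) (simp_all add: field_simps)
  qed
qed

text \<open>These are the leads of first points at \<open>t\<close> on arm \<open>m\<close> and at
  \<open>1 - t\<close> on all others, the pattern of a regular configuration that avoids the
  centre.\<close>

lemma start_fixed:
  assumes I: "finite I" "m \<in> I" "I \<noteq> {m}" and t: "0 \<le> t" "t \<le> 1"
    and wm: "\<And>j. j \<in> I \<Longrightarrow> j \<noteq> m \<Longrightarrow> w m j = 1 - 2 * t \<and> w j m = 2 * t - 1"
    and w0: "\<And>i j. i \<in> I \<Longrightarrow> j \<in> I \<Longrightarrow> i \<noteq> m \<Longrightarrow> j \<noteq> m \<Longrightarrow> w i j = 0"
    and i: "i \<in> I"
  shows "start w I i = (if i = m then t else 1 - t)"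
proof -
  have ne: "I - {m} \<noteq> {}" using I by blast
  have gm: "gap w I m = max 0 (1 - 2 * t)" "gap (\<lambda>i j. w j i) I m = max 0 (2 * t - 1)"
  proof -
    have "(\<lambda>j. max 0 (w m j)) ` (I - {m}) = {max 0 (1 - 2 * t)}"
      "(\<lambda>j. max 0 (w j m)) ` (I - {m}) = {max 0 (2 * t - 1)}"
      using ne wm by (auto simp: image_iff)
    then show "gap w I m = max 0 (1 - 2 * t)" "gap (\<lambda>i j. w j i) I m = max 0 (2 * t - 1)"
      unfolding gap_def using t by auto
  qed
  show ?thesis
  \<comment> \<open>With two arms the other arm may have nonzero gaps as well, and
    \<open>A = B\<close>. With more arms, the ties among the others make all their gaps
    vanish.\<close>
  proof (cases "\<exists>j. I = {m, j} \<and> j \<noteq> m")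
    case True
    then obtain j where j: "I = {m, j}" "j \<noteq> m" by blast
    have "I - {j} = {m}" using j by auto
    then have gj: "gap w I j = max 0 (2 * t - 1)" "gap (\<lambda>i j. w j i) I j = max 0 (1 - 2 * t)"
      unfolding gap_def using wm[of j] j t by auto
    show ?thesis
      using i j gm gj t unfolding start_def Let_def by (auto simp: max_def field_simps)
  next
    case False
    have gj: "gap w I j = 0 \<and> gap (\<lambda>i j. w j i) I j = 0" if "j \<in> I" "j \<noteq> m" for j
    proof -
      obtain j' where j': "j' \<in> I" "j' \<noteq> m" "j' \<noteq> j" using False I that by blast
      then show ?thesis
        using gap_le[OF I(1) j'(1) j'(3), of w] gap_le[OF I(1) j'(1) j'(3), of "\<lambda>i j. w j i"]
          gap_nonneg[OF I(1), of w j] gap_nonneg[OF I(1), of "\<lambda>i j. w j i" j] w0[of j j'] w0[of j' j] that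
        by simp
    qed
    have "sum (gap w I) I = gap w I m" "sum (gap (\<lambda>i j. w j i) I) I = gap (\<lambda>i j. w j i) I m"
      using gj I by (simp_all add: sum.remove)
    then show ?thesis
      using i gm gj[of i] t unfolding start_def Let_def by (auto simp: max_def field_simps)
  qed
qed

text \<open>A lead close to \<open>1\<close> makes \<open>A\<close> close to \<open>1\<close>, hence
  \<open>1 - 2 * \<delta> \<le> E\<close> because \<open>max A B \<le> 1\<close>, and so
  \<open>(1 - E) / 2 \<le> \<delta>\<close>. This estimate controls points that pass through the
  centre.\<close>

lemma start_near:
  assumes I: "finite I" "b \<in> I" and anti: "\<And>i j. w i j = - w j i" and \<delta>: "0 \<le> \<delta>"
    and near: "\<And>j. j \<in> I \<Longrightarrow> j \<noteq> b \<Longrightarrow> 1 - \<delta> \<le> w b j"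
  shows "\<bar>start w I b\<bar> \<le> \<delta>" "\<And>j. j \<in> I \<Longrightarrow> j \<noteq> b \<Longrightarrow> \<bar>start w I j - 1\<bar> \<le> \<delta>"
proof -
  have ne: "I \<noteq> {}" using I by blast
  obtain m p A B E where mp: "m \<in> I" "p \<in> I" and gm: "gap w I m = A" and gp: "gap (\<lambda>i j. w j i) I p = B"
    and AB: "0 \<le> A" "A \<le> 1" "0 \<le> B" "B \<le> 1"
    and zm0: "\<forall>i\<in>I. i \<noteq> m \<longrightarrow> gap w I i = 0"
    and E: "E = 2 * A - max A B"
    and st0: "\<forall>i\<in>I. start w I i = (1 + E) / 2 - (if i = m then max 0 E else 0) + (if i = p then max 0 (- E) else 0)"
    by (rule start_shape[where w = w, OF I(1) ne anti]) (rule that; assumption)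
  note zm = zm0[rule_format] and st = st0[rule_format]
  have gb: "1 - \<delta> \<le> gap w I b"
    using near \<delta> by (intro le_gap[OF I(1)]) (auto simp: le_max_iff_disj)
  \<comment> \<open>For \<open>1 \<le> \<delta>\<close> arm \<open>b\<close> need not be the leader,
    but then the bounds are trivial because all starts lie between \<open>0\<close> and
    \<open>1\<close>.\<close>
  then have mb: "m = b \<or> 1 \<le> \<delta>" and A: "1 - \<delta> \<le> A"
    using zm[OF I(2)] gm AB by (cases "m = b"; force)+
  have E1: "1 - 2 * \<delta> \<le> E" "-1 \<le> E" "E \<le> 1"
    using A AB by (auto simp: E max_def)
  show "\<bar>start w I b\<bar> \<le> \<delta>"
    using st[OF I(2)] E1 mb \<delta> by (auto simp: abs_le_iff max_def field_simps split: if_splits)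
  fix j assume j: "j \<in> I" "j \<noteq> b"
  show "\<bar>start w I j - 1\<bar> \<le> \<delta>"
    using st[OF j(1)] E1 mb j \<delta> by (auto simp: abs_le_iff max_def field_simps split: if_splits)
qed

section \<open>Continuous dependence of the starting positions on the leads\<close>

lemma tendsto_Min_image:
  fixes f :: "'a \<Rightarrow> 'b \<Rightarrow> real"
  assumes "finite S" "S \<noteq> {}" "\<And>j. j \<in> S \<Longrightarrow> ((\<lambda>z. f z j) \<longlongrightarrow> g j) F"
  shows "((\<lambda>z. Min (f z ` S)) \<longlongrightarrow> Min (g ` S)) F"
  using assms by (induction S rule: finite_ne_induct) (auto intro!: tendsto_min)

lemma tendsto_gap:
  assumes "finite I" "i \<in> I" "\<And>i j. i \<in> I \<Longrightarrow> j \<in> I \<Longrightarrow> i \<noteq> j \<Longrightarrow> ((\<lambda>z. w z i j) \<longlongrightarrow> w0 i j) F"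
  shows "((\<lambda>z. gap (w z) I i) \<longlongrightarrow> gap w0 I i) F"
proof (cases "I - {i} = {}")
  case True
  then show ?thesis unfolding gap_def True by simp
next
  case False
  have eq: "gap v I i = min 1 (Min ((\<lambda>j. max 0 (v i j)) ` (I - {i})))" for v
    unfolding gap_def using assms(1) False by (subst Min_insert) auto
  show ?thesis
    unfolding eq using assms False
    by (intro tendsto_min tendsto_const tendsto_Min_image tendsto_max) auto
qed

text \<open>For a fixed set of arms, \<open>start\<close> is built from minima, maxima and sums of
  the leads. The set of arms changes only near configurations containing the centre, which
  \<open>start_near\<close> covers.\<close>

lemma tendsto_start:
  assumes "finite I" "i \<in> I" "\<And>i j. i \<in> I \<Longrightarrow> j \<in> I \<Longrightarrow> i \<noteq> j \<Longrightarrow> ((\<lambda>z. w z i j) \<longlongrightarrow> w0 i j) F"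
  shows "((\<lambda>z. start (w z) I i) \<longlongrightarrow> start w0 I i) F"
proof -
  have g: "((\<lambda>z. gap (w z) I i) \<longlongrightarrow> gap w0 I i) F"
    "((\<lambda>z. gap (\<lambda>i j. w z j i) I i) \<longlongrightarrow> gap (\<lambda>i j. w0 j i) I i) F" if "i \<in> I" for i
    using assms that by (auto intro!: tendsto_gap)
  show ?thesis
    unfolding start_def Let_def using assms(2)
    by (intro tendsto_intros tendsto_max g tendsto_sum) auto
qed

section \<open>The sliding homotopy\<close>

text \<open>A point at the centre has first component \<open>0\<close> and thus forms an arm of its own.\<close>

definition arm_first :: "star_point set \<Rightarrow> nat \<Rightarrow> real" where
  "arm_first c i = Min (snd ` {y \<in> c. fst y = i})"

text \<open>Being a ratio, the lead is the same for simplicial and for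
  \<open>\<kappa>\<close>-scaled distances. An occupied centre leads every other arm by exactly
  \<open>1\<close>.\<close>

definition lead :: "star_point set \<Rightarrow> nat \<Rightarrow> nat \<Rightarrow> real" where
  "lead c i j = (arm_first c j - arm_first c i) / (arm_first c i + arm_first c j)"

definition below :: "star_point set \<Rightarrow> star_point \<Rightarrow> star_point set" where
  "below c y = {z \<in> c. fst z = fst y \<and> snd z < snd y}"

abbreviation arm_start :: "star_point set \<Rightarrow> nat \<Rightarrow> real" where
  "arm_start c i \<equiv> start (lead c) (fst ` c) i"

definition target :: "star_point set \<Rightarrow> star_point \<Rightarrow> real" where
  "target c y = arm_start c (fst y) + real (card (below c y))"

definition star_pt :: "nat \<Rightarrow> real \<Rightarrow> star_point" where
  "star_pt i t = (if t = 0 then (0, 0) else (i, t))"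

text \<open>Targets are distances for \<open>star_dist \<kappa>\<close>, hence the division by
  \<open>\<kappa>\<close>; \<open>star_pt\<close> identifies the coordinate \<open>0\<close> of all
  arms.\<close>

definition slide :: "real \<Rightarrow> star_point set \<Rightarrow> real \<Rightarrow> star_point \<Rightarrow> star_point" where
  "slide \<kappa> c u y = star_pt (fst y) ((1 - u) * snd y + u * (target c y / \<kappa>))"

lemma lead_anti: "lead c i j = - lead c j i"
  by (simp add: lead_def add.commute[of "arm_first c j"] minus_divide_left del: minus_divide_left[symmetric])

lemma snd_star_pt [simp]: "snd (star_pt i t) = t"
  by (simp add: star_pt_def)

lemma star_pt_self: "y \<in> star n \<Longrightarrow> star_pt (fst y) (snd y) = y"
  by (auto simp: star_pt_def star_def)

lemma star_pt_in_star: "\<lbrakk>y \<in> star n; 0 \<le> t; t \<le> 1; fst y = 0 \<Longrightarrow> t = 0\<rbrakk> \<Longrightarrow> star_pt (fst y) t \<in> star n"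
  by (auto simp: star_pt_def star_def)

lemma arm_first_attained:
  assumes "finite c" "i \<in> fst ` c"
  obtains f where "f \<in> c" "fst f = i" "snd f = arm_first c i"
    "\<And>y. y \<in> c \<Longrightarrow> fst y = i \<Longrightarrow> snd f \<le> snd y"
proof -
  let ?S = "snd ` {y \<in> c. fst y = i}"
  have S: "finite ?S" "?S \<noteq> {}" using assms by auto
  then have "Min ?S \<in> ?S" by (rule Min_in)
  then obtain f where "f \<in> c" "fst f = i" "snd f = arm_first c i"
    by (auto simp: arm_first_def)
  moreover have "snd f \<le> snd y" if "y \<in> c" "fst y = i" for y
    using Min_le[OF S(1), of "snd y"] that calculation(3) by (auto simp: arm_first_def)
  ultimately show ?thesis by (rule that)
qed

lemma arm_first_eqI:
  assumes "finite c" "f \<in> c" "fst f = i" "\<And>y. y \<in> c \<Longrightarrow> fst y = i \<Longrightarrow> snd f \<le> snd y"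
  shows "arm_first c i = snd f"
  unfolding arm_first_def using assms by (intro Min_eqI) auto

lemma finite_below: "finite c \<Longrightarrow> finite (below c y)"
  by (simp add: below_def)

lemma card_below_mono:
  assumes "finite c" "y \<in> c" "fst y = fst z" "snd y < snd z"
  shows "card (below c y) < card (below c z)"
  using assms by (intro psubset_card_mono) (auto simp: below_def)

text \<open>The ranks on an arm are distinct and smaller than its number of points, so they exhaust
  an initial segment. The targets on an arm are therefore unit steps from its start.\<close>

lemma card_below_image:
  assumes "finite c"
  shows "(\<lambda>y. card (below c y)) ` {y \<in> c. fst y = i} = {..<card {y \<in> c. fst y = i}}"
proof (rule card_subset_eq)
  let ?S = "{y \<in> c. fst y = i}"
  show "(\<lambda>y. card (below c y)) ` ?S \<subseteq> {..<card ?S}"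
  proof clarsimp
    fix b assume b: "(i, b) \<in> c"
    then have "below c (i, b) \<subseteq> ?S - {(i, b)}" "(i, b) \<in> ?S"
      by (auto simp: below_def)
    then show "card (below c (i, b)) < card ?S"
      using finite_subset[OF _ assms, of ?S] by (intro psubset_card_mono) blast+
  qed
  have "inj_on (\<lambda>y. card (below c y)) ?S"
  proof (rule inj_onI)
    fix x y assume *: "x \<in> ?S" "y \<in> ?S" "card (below c x) = card (below c y)"
    then show "x = y"
      using card_below_mono[OF assms, of x y] card_below_mono[OF assms, of y x]
      by (cases "snd x < snd y"; cases "snd y < snd x") (auto simp: prod_eq_iff)
  qed
  then show "card ((\<lambda>y. card (below c y)) ` ?S) = card {..<card ?S}"
    by (simp add: card_image)
qed simp

section \<open>Starts, targets and slides of one configuration\<close>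

context
  fixes n :: nat and c :: "star_point set"
  assumes c: "c \<subseteq> star n" "finite c" "c \<noteq> {}"
begin

lemma arm_first_nonneg: "i \<in> fst ` c \<Longrightarrow> 0 \<le> arm_first c i \<and> (arm_first c i = 0 \<longleftrightarrow> i = 0)"
  by (rule arm_first_attained[OF c(2)]) (use c(1) star_coords in \<open>auto 0 3\<close>)

lemma arm_start_governed:
  obtains m where "m \<in> fst ` c" "0 \<le> arm_start c m" "arm_start c m < 1"
    "\<And>i. i \<in> fst ` c \<Longrightarrow> i \<noteq> m \<Longrightarrow> arm_start c i = 1 - arm_start c m"
proof (rule start_governed[where w = "lead c" and I = "fst ` c"])
  \<comment> \<open>A lead of \<open>1\<close> forces the first point to height \<open>0\<close>, so
    the arm is the centre; this gives the uniqueness required by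
    \<open>start_governed\<close>.\<close>
  have zero: "i = 0" if "i \<in> fst ` c" "j \<in> fst ` c" "1 \<le> lead c i j" for i j
  proof -
    have "arm_first c i + arm_first c j \<noteq> 0"
      using that(3) by (auto simp: lead_def)
    then have "0 < arm_first c i + arm_first c j"
      using arm_first_nonneg[OF that(1)] arm_first_nonneg[OF that(2)] by linarith
    then show "i = 0"
      using that(3) arm_first_nonneg[OF that(1)] by (auto simp: lead_def field_simps)
  qed
  show "i = i'" if "i \<in> fst ` c" "j \<in> fst ` c" "i' \<in> fst ` c" "j' \<in> fst ` c"
    "1 \<le> lead c i j" "1 \<le> lead c i' j'" for i j i' j'
    using zero that by metis
qed (use c in \<open>auto intro: lead_anti that\<close>)

lemma arm_start_bounds: "i \<in> fst ` c \<Longrightarrow> 0 \<le> arm_start c i \<and> arm_start c i \<le> 1"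
  by (rule arm_start_governed) (metis diff_ge_0_iff_ge diff_le_eq le_add_same_cancel1 less_imp_le)

text \<open>If the governing arm starts at \<open>0\<close>, all others start at \<open>1\<close>;
  otherwise every start is positive, the governing one being less than \<open>1\<close>.\<close>

lemma arm_start_zero_unique:
  "\<lbrakk>i \<in> fst ` c; j \<in> fst ` c; arm_start c i = 0; arm_start c j = 0\<rbrakk> \<Longrightarrow> i = j"
  by (rule arm_start_governed) (metis diff_0_right eq_iff_diff_eq_0 less_irrefl)

text \<open>If \<open>q\<close> is the height of the low point and \<open>q' \<ge> \<eta>\<close>
  the first height on another arm, the lead is \<open>1 - 2 * q / (q + q')\<close>. So
  \<open>start_near\<close> applies with \<open>\<delta> = 2 * \<epsilon> / \<eta>\<close>.\<close>

lemma arm_start_near: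
  assumes y: "y \<in> c" "snd y \<le> \<epsilon>" and \<eta>: "0 < \<eta>" and far: "\<And>z. z \<in> c \<Longrightarrow> z \<noteq> y \<Longrightarrow> \<eta> \<le> snd z"
    and lt: "\<epsilon> < \<eta>"
  shows "\<bar>arm_start c (fst y)\<bar> \<le> 2 * \<epsilon> / \<eta>"
    "\<And>j. j \<in> fst ` c \<Longrightarrow> j \<noteq> fst y \<Longrightarrow> \<bar>arm_start c j - 1\<bar> \<le> 2 * \<epsilon> / \<eta>"
proof -
  have y0: "0 \<le> snd y" using y(1) c(1) star_coords by blast
  have fy: "arm_first c (fst y) = snd y"
  proof (rule arm_first_eqI[OF c(2) y(1) refl])
    show "snd y \<le> snd z" if "z \<in> c" for z
      using y(2) far[OF that] lt by (cases "z = y") auto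
  qed
  have near: "1 - 2 * \<epsilon> / \<eta> \<le> lead c (fst y) j" if j: "j \<in> fst ` c" "j \<noteq> fst y" for j
  proof -
    obtain f where "f \<in> c" "fst f = j" "snd f = arm_first c j"
      by (rule arm_first_attained[OF c(2) j(1)])
    then have q: "\<eta> \<le> arm_first c j" using far[of f] j(2) by auto
    have "1 - lead c (fst y) j = 2 * snd y / (snd y + arm_first c j)"
      using q \<eta> y0 unfolding lead_def fy by (simp add: field_simps)
    also have "\<dots> \<le> 2 * \<epsilon> / \<eta>"
      using y y0 q \<eta> by (intro frac_le) auto
    finally show ?thesis by simp
  qed
  have \<delta>: "0 \<le> 2 * \<epsilon> / \<eta>" using y y0 \<eta> by simp
  show "\<bar>arm_start c (fst y)\<bar> \<le> 2 * \<epsilon> / \<eta>"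
    "\<And>j. j \<in> fst ` c \<Longrightarrow> j \<noteq> fst y \<Longrightarrow> \<bar>arm_start c j - 1\<bar> \<le> 2 * \<epsilon> / \<eta>"
    using start_near[where w = "lead c", OF finite_imageI[OF c(2), of fst] imageI[OF y(1), of fst] lead_anti \<delta> near] by auto
qed

lemma arm_start_center:
  assumes "(0, 0) \<in> c" "i \<in> fst ` c"
  shows "arm_start c i = (if i = 0 then 0 else 1)"
proof -
  \<comment> \<open>The least height off the centre, capped by \<open>1\<close> so that the minimum
    is over a nonempty set; the estimate for \<open>\<epsilon> = 0\<close> is then an
    equality.\<close>
  define \<eta> where "\<eta> = Min (insert 1 (snd ` (c - {(0, 0)})))"
  have pos: "0 < snd z" if "z \<in> c" "z \<noteq> (0, 0)" for z
    using that c(1) by (auto simp: star_def)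
  have "0 < \<eta>" "\<And>z. z \<in> c \<Longrightarrow> z \<noteq> (0, 0) \<Longrightarrow> \<eta> \<le> snd z"
    using c(2) pos by (auto simp: \<eta>_def)
  then show ?thesis
    using arm_start_near[OF assms(1), of 0 \<eta>] assms(2) by auto
qed

lemma target_nonneg: "y \<in> c \<Longrightarrow> 0 \<le> target c y"
  using arm_start_bounds[of "fst y"] by (simp add: target_def)

lemma target_center: "y \<in> c \<Longrightarrow> fst y = 0 \<Longrightarrow> target c y = 0"
proof -
  assume y: "y \<in> c" "fst y = 0"
  then have "y = (0, 0)" using c(1) by (auto simp: star_def)
  moreover have "below c (0, 0) = {}"
    using c(1) star_coords by (force simp: below_def)
  ultimately show ?thesis
    using arm_start_center[of 0] y imageI[of y c fst] by (simp add: target_def)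
qed

lemma target_strict_mono:
  "\<lbrakk>y \<in> c; z \<in> c; fst y = fst z; snd y < snd z\<rbrakk> \<Longrightarrow> target c y < target c z"
  using card_below_mono[OF c(2)] by (simp add: target_def)

lemma target_zero_unique:
  assumes "y \<in> c" "z \<in> c" "target c y = 0" "target c z = 0"
  shows "y = z"
proof -
  have "arm_start c (fst y) = 0" "arm_start c (fst z) = 0"
    using assms arm_start_bounds[of "fst y"] arm_start_bounds[of "fst z"] by (auto simp: target_def)
  then have "fst y = fst z"
    using assms by (intro arm_start_zero_unique) auto
  then show ?thesis
    using target_strict_mono[of y z] target_strict_mono[of z y] assms
    by (cases "snd y" "snd z" rule: linorder_cases) (auto simp: prod_eq_iff)
qed

text \<open>On a single arm the start is \<open>0\<close>. With several arms the start may reach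
  \<open>1\<close>, but some point lies on another arm and so is not counted by
  \<open>below\<close>. Together with \<open>real k - 1 \<le> \<kappa>\<close> this keeps the slide
  on the star.\<close>

lemma target_le: "y \<in> c \<Longrightarrow> target c y \<le> real (card c) - 1"
proof -
  assume y: "y \<in> c"
  show ?thesis
  proof (cases "fst ` c = {fst y}")
    case True
    have "card (below c y) < card c"
      using y c(2) by (intro psubset_card_mono) (auto simp: below_def)
    then show ?thesis by (simp add: target_def True start_singleton)
  next
    case False
    then obtain z where z: "z \<in> c" "fst z \<noteq> fst y" using y by blast
    have "card (insert y (insert z (below c y))) \<le> card c"
      using y z c(2) by (intro card_mono) (auto simp: below_def)
    moreover have "y \<notin> insert z (below c y)" "z \<notin> below c y"
      using z by (auto simp: below_def)
    ultimately have "card (below c y) + 2 \<le> card c"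
      using finite_below[OF c(2)] by simp
    then show ?thesis
      using arm_start_bounds[of "fst y"] y by (simp add: target_def)
  qed
qed

lemma slide_in_star:
  assumes \<kappa>: "0 < \<kappa>" "real (card c) - 1 \<le> \<kappa>" and u: "0 \<le> u" "u \<le> 1" and y: "y \<in> c"
  shows "slide \<kappa> c u y \<in> star n"
proof -
  have y1: "0 \<le> snd y" "snd y \<le> 1" using y c(1) by (auto simp: star_def)
  have t: "0 \<le> target c y / \<kappa>" "target c y / \<kappa> \<le> 1"
    using target_nonneg[OF y] target_le[OF y] \<kappa> by auto
  show ?thesis
    unfolding slide_def
  proof (rule star_pt_in_star)
    show "0 \<le> (1 - u) * snd y + u * (target c y / \<kappa>)"
      using u t y1 by (intro add_nonneg_nonneg mult_nonneg_nonneg) auto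
    have "(1 - u) * snd y + u * (target c y / \<kappa>) \<le> (1 - u) * 1 + u * 1"
      using u t y1 by (intro add_mono mult_left_mono) auto
    then show "(1 - u) * snd y + u * (target c y / \<kappa>) \<le> 1" by simp
    show "y \<in> star n" using y c(1) by blast
    then show "(1 - u) * snd y + u * (target c y / \<kappa>) = 0" if "fst y = 0"
      using target_center[OF y that] that star_coords by simp
  qed
qed

text \<open>Along each arm the height stays strictly increasing at every time, and points of
  different arms can meet only at the centre.\<close>

lemma slide_inj_on:
  assumes \<kappa>: "0 < \<kappa>" and u: "0 \<le> u" "u \<le> 1"
  shows "inj_on (slide \<kappa> c u) c"
proof -
  define h where "h y = (1 - u) * snd y + u * (target c y / \<kappa>)" for y
  have mono: "h y < h z" if "y \<in> c" "z \<in> c" "fst y = fst z" "snd y < snd z" for y z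
  proof (cases "u = 0")
    case False
    have "u * (target c y / \<kappa>) < u * (target c z / \<kappa>)"
      using target_strict_mono[OF that] False u \<kappa> by (intro mult_strict_left_mono divide_strict_right_mono) auto
    moreover have "(1 - u) * snd y \<le> (1 - u) * snd z"
      using that u by (intro mult_left_mono) auto
    ultimately show ?thesis unfolding h_def by linarith
  qed (use that in \<open>simp add: h_def\<close>)
  \<comment> \<open>Before time \<open>1\<close> only a point that began at the centre can have
    height \<open>0\<close>; at time \<open>1\<close> height \<open>0\<close> means target
    \<open>0\<close>, which at most one point has.\<close>
  have zero: "y = z" if yz: "y \<in> c" "z \<in> c" "h y = 0" "h z = 0" for y z
  proof (cases "u = 1")
    case True
    then show ?thesis using yz \<kappa> by (intro target_zero_unique) (auto simp: h_def)
  next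
    case False
    have "snd x = 0" if x: "x \<in> c" "h x = 0" for x
    proof -
      have "0 \<le> (1 - u) * snd x" "0 \<le> u * (target c x / \<kappa>)"
        using u \<kappa> target_nonneg[OF x(1)] star_coords[OF subsetD[OF c(1) x(1)]] by auto
      then have "(1 - u) * snd x = 0" using x(2) unfolding h_def by linarith
      then show ?thesis using False by simp
    qed
    then show ?thesis
      using yz c(1) star_coords by (metis prod_eq_iff subset_iff)
  qed
  show ?thesis
  proof (rule inj_onI)
    fix y z assume yz: "y \<in> c" "z \<in> c" "slide \<kappa> c u y = slide \<kappa> c u z"
    have eq: "star_pt (fst y) (h y) = star_pt (fst z) (h z)"
      using yz(3) by (simp add: slide_def h_def)
    then have h: "h y = h z" by (metis snd_star_pt)
    show "y = z"
    proof (cases "h y = 0")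
      case True
      then show ?thesis using zero yz h by simp
    next
      case False
      then have "fst y = fst z" using eq h by (simp add: star_pt_def)
      then show ?thesis
        using mono[of y z] mono[of z y] yz h
        by (cases "snd y" "snd z" rule: linorder_cases) (auto simp: prod_eq_iff)
    qed
  qed
qed

end

section \<open>Regular configurations\<close>

lemma star_dist_same: "fst x = fst y \<Longrightarrow> star_dist \<kappa> x y = \<kappa> * \<bar>snd x - snd y\<bar>"
  by (simp add: star_dist_def star_simplicial_dist_def)

lemma star_dist_diff:
  "\<lbrakk>x \<in> star n; y \<in> star n; fst x \<noteq> fst y\<rbrakk> \<Longrightarrow> star_dist \<kappa> x y = \<kappa> * (snd x + snd y)"
  using star_coords[of x] star_coords[of y] by (simp add: star_dist_def star_simplicial_dist_def)

lemma star_segment_iff: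
  assumes "0 < \<kappa>" "x \<in> star n" "y \<in> star n" "z \<in> star n"
  shows "z \<in> star_segment n \<kappa> x y \<longleftrightarrow>
    (if fst x = fst y then fst z = fst x \<and> min (snd x) (snd y) \<le> snd z \<and> snd z \<le> max (snd x) (snd y)
     else fst z = 0 \<or> (fst z = fst x \<and> snd z \<le> snd x) \<or> (fst z = fst y \<and> snd z \<le> snd y))"
proof -
  have "z \<in> star_segment n \<kappa> x y \<longleftrightarrow>
      star_simplicial_dist x z + star_simplicial_dist z y = star_simplicial_dist x y"
    using assms by (simp add: star_segment_eq star_dist_def flip: distrib_left)
  then show ?thesis
    using star_coords[OF assms(2)] star_coords[OF assms(3)] star_coords[OF assms(4)]
    unfolding star_simplicial_dist_def min_def max_def by (smt (verit))
qed

lemma star_vertex_in_star: "i \<le> n \<Longrightarrow> star_vertex i \<in> star n"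
  by (auto simp: star_vertex_def star_def)

lemma arm_eq:
  assumes "0 < \<kappa>" "c \<subseteq> star n" "i \<in> {1..n}"
  shows "arm n \<kappa> i c = {z \<in> c. fst z = 0 \<or> fst z = i}"
proof -
  have "z \<in> star_segment n \<kappa> (star_vertex 0) (star_vertex i) \<longleftrightarrow> fst z = 0 \<or> fst z = i" if "z \<in> c" for z
  proof -
    have "z \<in> star n" "snd z \<le> 1" using that assms(2) by (auto simp: star_def)
    then show ?thesis
      using assms(3) star_coords[of z n] star_vertex_in_star[of 0 n] star_vertex_in_star[of i n]
      by (subst star_segment_iff[OF assms(1)]) (auto simp: star_vertex_def)
  qed
  then show ?thesis by (auto simp: arm_def)
qed

section \<open>Regular configurations do not move\<close>

lemma chain_card:
  "chain n \<kappa> C \<Longrightarrow> x \<in> C \<Longrightarrow> y \<in> C \<Longrightarrow> real (card (C \<inter> star_segment n \<kappa> x y)) = 1 + star_dist \<kappa> x y"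
  by (simp add: chain_def)

text \<open>The chain conditions force unit spacing along each arm. If the centre is occupied, all
  positions are integers; if not, the first points lie at \<open>t\<close> on the governing arm and
  at \<open>1 - t\<close> on the others, so \<open>start_fixed\<close> applies.\<close>

lemma regular_imp_target:
  assumes \<kappa>: "0 < \<kappa>" and c: "c \<subseteq> star n" "finite c" and reg: "regular n \<kappa> c" and y: "y \<in> c"
  shows "\<kappa> * snd y = target c y"
proof -
  have ne: "c \<noteq> {}" using y by blast
  note coords = star_coords[OF subsetD[OF c(1)]]
  obtain m where m: "m \<in> {1..n}" "arm n \<kappa> m c \<noteq> {}"
      "\<And>i. i \<in> {1..n} \<Longrightarrow> chain n \<kappa> {z \<in> c. fst z \<in> {0, m, i}}"
    and two: "2 \<le> card {i \<in> {1..n}. arm n \<kappa> i c \<noteq> {}}"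
  proof -
    obtain m where m: "m \<in> {1..n}" "arm n \<kappa> m c \<noteq> {}"
        "\<forall>i\<in>{1..n}. chain n \<kappa> (arm n \<kappa> m c \<union> arm n \<kappa> i c)"
      using reg unfolding regular_def by blast
    have "arm n \<kappa> m c \<union> arm n \<kappa> i c = {z \<in> c. fst z \<in> {0, m, i}}" if "i \<in> {1..n}" for i
      using arm_eq[OF \<kappa> c(1)] m(1) that by auto
    then show thesis
      using that[of m] m reg by (auto simp: regular_def)
  qed
  have arms: "fst z = 0 \<or> fst z \<in> {1..n}" if "z \<in> c" for z
    using that c(1) by (auto simp: star_def)
  \<comment> \<open>The segment from the first point \<open>f\<close> to \<open>z\<close> holds just
    \<open>z\<close> and the points below it, so the chain condition puts \<open>z\<close> exactly
    \<open>card (below c z)\<close> beyond \<open>f\<close>.\<close>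
  have along: "\<kappa> * snd z = \<kappa> * snd f + card (below c z)"
    if z: "z \<in> c" "fst z \<noteq> 0" and f: "f \<in> c" "fst f = fst z" "\<And>w. w \<in> c \<Longrightarrow> fst w = fst z \<Longrightarrow> snd f \<le> snd w"
    for z f
  proof -
    let ?C = "{w \<in> c. fst w \<in> {0, m, fst z}}"
    have iff: "w \<in> star_segment n \<kappa> f z \<longleftrightarrow> fst w = fst z \<and> snd w \<le> snd z" if "w \<in> c" for w
      using \<kappa> c(1) z f(1,2) that f(3)[OF that] f(3)[OF z(1)] by (subst star_segment_iff) (auto simp: min_def max_def)
    have "?C \<inter> star_segment n \<kappa> f z = insert z (below c z)"
    proof (intro set_eqI iffI)
      fix w assume w: "w \<in> ?C \<inter> star_segment n \<kappa> f z"
      then have "w \<in> c" "fst w = fst z" "snd w \<le> snd z" using iff[of w] by auto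
      then show "w \<in> insert z (below c z)"
        by (cases "snd w = snd z") (auto simp: below_def prod_eq_iff)
    next
      fix w assume "w \<in> insert z (below c z)"
      then show "w \<in> ?C \<inter> star_segment n \<kappa> f z"
        using iff[of w] z by (auto simp: below_def)
    qed
    moreover have "z \<notin> below c z" by (simp add: below_def)
    moreover have "chain n \<kappa> ?C" using m(3) arms[OF z(1)] z(2) by blast
    then have "real (card (?C \<inter> star_segment n \<kappa> f z)) = 1 + star_dist \<kappa> f z"
      using z f by (intro chain_card) auto
    ultimately have "real (card (below c z)) = \<kappa> * (snd z - snd f)"
      using finite_below[OF c(2)] f(3)[OF z(1)] star_dist_same[of f z \<kappa>] f(2) by simp
    then show ?thesis by (simp add: algebra_simps)
  qed
  \<comment> \<open>Without the centre, the first points of the governing arm and of another arm are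
    neighbours in the chain, so their distance is \<open>1\<close>.\<close>
  have pair: "\<kappa> * (snd f + snd g) = 1"
    if "(0, 0) \<notin> c" and f: "f \<in> c" "fst f = m" "\<And>w. w \<in> c \<Longrightarrow> fst w = m \<Longrightarrow> snd f \<le> snd w"
      and g: "g \<in> c" "fst g \<noteq> m" "\<And>w. w \<in> c \<Longrightarrow> fst w = fst g \<Longrightarrow> snd g \<le> snd w" for f g
  proof -
    let ?C = "{w \<in> c. fst w \<in> {0, m, fst g}}"
    have no: "fst w \<noteq> 0" if "w \<in> c" for w
      using that \<open>(0, 0) \<notin> c\<close> coords[OF that] by (metis prod.collapse)
    have iff: "w \<in> star_segment n \<kappa> f g \<longleftrightarrow> (fst w = fst f \<and> snd w \<le> snd f) \<or> (fst w = fst g \<and> snd w \<le> snd g)"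
      if "w \<in> c" for w
      using \<kappa> c(1) f g that no[OF that] by (subst star_segment_iff) auto
    have "?C \<inter> star_segment n \<kappa> f g = {f, g}"
    proof (intro set_eqI iffI)
      fix w assume w: "w \<in> ?C \<inter> star_segment n \<kappa> f g"
      then show "w \<in> {f, g}"
        using iff[of w] f(2) f(3)[of w] g(3)[of w] by (auto simp: prod_eq_iff)
    next
      fix w assume "w \<in> {f, g}"
      then show "w \<in> ?C \<inter> star_segment n \<kappa> f g"
        using iff[of w] f g by auto
    qed
    moreover have "f \<noteq> g" using f g by auto
    moreover have "chain n \<kappa> ?C" using m(3) arms[OF g(1)] no[OF g(1)] by blast
    then have "real (card (?C \<inter> star_segment n \<kappa> f g)) = 1 + star_dist \<kappa> f g"
      using f g by (intro chain_card) auto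
    moreover have "star_dist \<kappa> f g = \<kappa> * (snd f + snd g)"
      using f g c(1) by (intro star_dist_diff) auto
    ultimately show ?thesis by simp
  qed
  show ?thesis
  proof (cases "(0, 0) \<in> c")
    case center: True
    show ?thesis
    proof (cases "fst y = 0")
      case True
      then show ?thesis using target_center[OF c ne y] coords[OF y] by simp
    next
      case False
      let ?C = "{w \<in> c. fst w \<in> {0, m, fst y}}"
      have iff: "w \<in> star_segment n \<kappa> (0, 0) y \<longleftrightarrow> fst w = 0 \<or> fst w = fst y \<and> snd w \<le> snd y"
        if "w \<in> c" for w
        using \<kappa> c(1) y center False that by (subst star_segment_iff) auto
      have "?C \<inter> star_segment n \<kappa> (0, 0) y = insert (0, 0) (insert y (below c y))"
      proof (intro set_eqI iffI)
        fix w assume w: "w \<in> ?C \<inter> star_segment n \<kappa> (0, 0) y"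
        then have "w \<in> c" "fst w = 0 \<or> fst w = fst y \<and> snd w \<le> snd y" using iff[of w] by auto
        then show "w \<in> insert (0, 0) (insert y (below c y))"
          using coords[of w] by (cases "snd w = snd y") (auto simp: below_def prod_eq_iff)
      next
        fix w assume "w \<in> insert (0, 0) (insert y (below c y))"
        then show "w \<in> ?C \<inter> star_segment n \<kappa> (0, 0) y"
          using iff[of w] y center by (auto simp: below_def)
      qed
      moreover have "(0, 0) \<notin> insert y (below c y)" "y \<notin> below c y"
        using False by (auto simp: below_def)
      moreover have "chain n \<kappa> ?C" using m(3) arms[OF y] False by blast
      then have "real (card (?C \<inter> star_segment n \<kappa> (0, 0) y)) = 1 + star_dist \<kappa> (0, 0) y"
        using y center by (intro chain_card) auto
      moreover have "star_dist \<kappa> (0, 0) y = \<kappa> * snd y"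
        using coords[OF y] by (simp add: star_dist_def star_simplicial_dist_def)
      \<comment> \<open>The centre is an arm of its own and is not counted by \<open>below\<close>;
        the start \<open>1\<close> makes up for it.\<close>
      moreover have "target c y = 1 + card (below c y)"
        using arm_start_center[OF c ne center, of "fst y"] y False by (simp add: target_def)
      ultimately show ?thesis
        using finite_below[OF c(2)] by simp
    qed
  next
    case False
    have no: "fst w \<noteq> 0" if "w \<in> c" for w
      using that False coords[OF that] by (metis prod.collapse)
    have occ: "i \<in> fst ` c" if i: "i \<in> {1..n}" "arm n \<kappa> i c \<noteq> {}" for i
    proof -
      obtain w where "w \<in> c" "fst w = 0 \<or> fst w = i"
        using i(2) arm_eq[OF \<kappa> c(1) i(1)] by auto
      then show ?thesis using no[of w] by auto
    qed
    then have mI: "m \<in> fst ` c" using m(1,2) by simp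
    have "{i \<in> {1..n}. arm n \<kappa> i c \<noteq> {}} \<subseteq> fst ` c"
      using occ by auto
    then have "2 \<le> card (fst ` c)"
      by (rule order.trans[OF two card_mono[OF finite_imageI[OF c(2)]]])
    \<comment> \<open>A lone arm would be sent to start \<open>0\<close> wherever it begins; the
      requirement of two arms excludes it.\<close>
    then have nsing: "fst ` c \<noteq> {m}" by auto
    define q where "q i = \<kappa> * arm_first c i" for i
    obtain f where f: "f \<in> c" "fst f = m" "snd f = arm_first c m" "\<And>w. w \<in> c \<Longrightarrow> fst w = m \<Longrightarrow> snd f \<le> snd w"
      using arm_first_attained[OF c(2) mI] by metis
    have qpair: "q j = 1 - q m" if j: "j \<in> fst ` c" "j \<noteq> m" for j
    proof -
      obtain g where g: "g \<in> c" "fst g = j" "snd g = arm_first c j" "\<And>w. w \<in> c \<Longrightarrow> fst w = j \<Longrightarrow> snd g \<le> snd w"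
        using arm_first_attained[OF c(2) j(1)] by metis
      show ?thesis
        using pair[OF False f(1,2,4) g(1)] g j f(3) by (simp add: q_def algebra_simps)
    qed
    have q0: "0 \<le> q i" if "i \<in> fst ` c" for i
      using arm_first_nonneg[OF c ne that] \<kappa> by (simp add: q_def)
    have lead: "lead c i j = (q j - q i) / (q i + q j)" for i j
      using \<kappa> by (simp add: lead_def q_def flip: right_diff_distrib distrib_left)
    obtain j where "j \<in> fst ` c" "j \<noteq> m" using nsing mI by blast
    then have qm1: "q m \<le> 1" using qpair q0 by force
    have "arm_start c i = (if i = m then q m else 1 - q m)" if i: "i \<in> fst ` c" for i
    proof (rule start_fixed[OF finite_imageI[OF c(2)] mI nsing q0[OF mI] qm1 _ _ i])
      show "lead c m j = 1 - 2 * q m \<and> lead c j m = 2 * q m - 1" if "j \<in> fst ` c" "j \<noteq> m" for j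
        unfolding lead qpair[OF that] by simp
      show "lead c i j = 0" if "i \<in> fst ` c" "j \<in> fst ` c" "i \<noteq> m" "j \<noteq> m" for i j
        unfolding lead qpair[OF that(1,3)] qpair[OF that(2,4)] by simp
    qed
    then have "arm_start c i = q i" if "i \<in> fst ` c" for i
      using that qpair by simp
    moreover obtain g where g: "g \<in> c" "fst g = fst y" "snd g = arm_first c (fst y)"
        "\<And>w. w \<in> c \<Longrightarrow> fst w = fst y \<Longrightarrow> snd g \<le> snd w"
      using arm_first_attained[OF c(2) imageI[OF y]] by metis
    ultimately show ?thesis
      using along[OF y no[OF y] g(1,2,4)] y by (simp add: target_def q_def)
  qed
qed

lemma slide_fixes_regular:
  assumes "0 < \<kappa>" "c \<subseteq> star n" "finite c" "regular n \<kappa> c" "y \<in> c"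
  shows "slide \<kappa> c u y = y"
proof -
  have "target c y / \<kappa> = snd y"
    using regular_imp_target[OF assms] assms(1) by (simp add: field_simps)
  then have "slide \<kappa> c u y = star_pt (fst y) (snd y)"
    by (simp add: slide_def algebra_simps)
  also have "\<dots> = y" using assms(2,5) by (intro star_pt_self) auto
  finally show ?thesis .
qed

section \<open>The final configuration is regular\<close>

text \<open>The signed coordinate \<open>\<sigma>\<close> maps the two arms isometrically into the real line, where \<open>C\<close> becomes
  an interval of a translate of the integers.\<close>

lemma chainI:
  fixes a :: real
  assumes \<kappa>: "0 < \<kappa>" and C: "C \<subseteq> star n" "finite C" "\<And>z. z \<in> C \<Longrightarrow> fst z = 0 \<or> fst z = i \<or> fst z = m"
    and pos: "(\<lambda>z. \<kappa> * snd z) ` {z \<in> C. fst z = 0 \<or> fst z = i} = (\<lambda>l. a + real l) ` {..<p}"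
    and neg: "(\<lambda>z. \<kappa> * snd z) ` {z \<in> C. fst z \<noteq> 0 \<and> fst z \<noteq> i} = (\<lambda>l. 1 - a + real l) ` {..<q}"
  shows "chain n \<kappa> C"
proof -
  define \<sigma> where "\<sigma> z = \<kappa> * (if fst z = 0 \<or> fst z = i then snd z else - snd z)" for z :: star_point
  have dist: "star_dist \<kappa> x y = \<bar>\<sigma> x - \<sigma> y\<bar>" if "x \<in> C" "y \<in> C" for x y
  proof -
    let ?s = "\<lambda>z. if fst z = 0 \<or> fst z = i then snd z else - snd z"
    have "0 \<le> snd x \<and> (fst x = 0 \<longleftrightarrow> snd x = 0)" "0 \<le> snd y \<and> (fst y = 0 \<longleftrightarrow> snd y = 0)"
      using that C(1) star_coords by blast+
    then have "star_simplicial_dist x y = \<bar>?s x - ?s y\<bar>"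
      using C(3)[OF that(1)] C(3)[OF that(2)] unfolding star_simplicial_dist_def by (smt (verit))
    then show ?thesis
      using \<kappa> by (simp add: star_dist_def \<sigma>_def abs_mult flip: right_diff_distrib del: if_split)
  qed
  have inj: "inj_on \<sigma> C"
  proof (rule inj_onI)
    fix x y assume *: "x \<in> C" "y \<in> C" "\<sigma> x = \<sigma> y"
    then have "star_dist \<kappa> x y = 0" using dist by simp
    then show "x = y"
      using Metric_space.zero[OF Metric_space_star[OF \<kappa>]] C(1) * by blast
  qed
  \<comment> \<open>The left end of the interval: the values \<open>- (1 - a + l)\<close> with
    \<open>l < q\<close> are \<open>r, ..., a - 1\<close>, directly below the values
    \<open>a, a + 1, ...\<close> of the other side.\<close>
  define r where "r = a - real q"
  have "\<sigma> ` C = (\<lambda>l. r + real l) ` {..<p + q}"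
  proof -
    have "\<sigma> ` C = (\<lambda>z. \<kappa> * snd z) ` {z \<in> C. fst z = 0 \<or> fst z = i}
        \<union> uminus ` (\<lambda>z. \<kappa> * snd z) ` {z \<in> C. fst z \<noteq> 0 \<and> fst z \<noteq> i}"
    proof -
      have "\<sigma> ` C = \<sigma> ` {z \<in> C. fst z = 0 \<or> fst z = i} \<union> \<sigma> ` {z \<in> C. fst z \<noteq> 0 \<and> fst z \<noteq> i}"
        by blast
      then show ?thesis
        unfolding image_image by (simp add: \<sigma>_def cong: image_cong_simp)
    qed
    also have "\<dots> = (\<lambda>l. r + real l) ` {q..<p + q} \<union> (\<lambda>l. r + real l) ` {..<q}"
    proof (rule arg_cong2[where f = "(\<union>)"])
      show "(\<lambda>z. \<kappa> * snd z) ` {z \<in> C. fst z = 0 \<or> fst z = i} = (\<lambda>l. r + real l) ` {q..<p + q}"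
        unfolding pos
      proof (intro equalityI image_subsetI)
        show "a + real l \<in> (\<lambda>l. r + real l) ` {q..<p + q}" if "l \<in> {..<p}" for l
          using that by (intro image_eqI[of _ _ "l + q"]) (auto simp: r_def)
        show "r + real l \<in> (\<lambda>l. a + real l) ` {..<p}" if "l \<in> {q..<p + q}" for l
          using that by (intro image_eqI[of _ _ "l - q"]) (auto simp: r_def)
      qed
      show "uminus ` (\<lambda>z. \<kappa> * snd z) ` {z \<in> C. fst z \<noteq> 0 \<and> fst z \<noteq> i} = (\<lambda>l. r + real l) ` {..<q}"
        unfolding neg image_image
      proof (intro equalityI image_subsetI)
        show "- (1 - a + real l) \<in> (\<lambda>l. r + real l) ` {..<q}" if "l \<in> {..<q}" for l
          using that by (intro image_eqI[of _ _ "q - 1 - l"]) (auto simp: r_def of_nat_diff)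
        show "r + real l \<in> (\<lambda>l. - (1 - a + real l)) ` {..<q}" if "l \<in> {..<q}" for l
          using that by (intro image_eqI[of _ _ "q - 1 - l"]) (auto simp: r_def of_nat_diff)
      qed
    qed
    also have "\<dots> = (\<lambda>l. r + real l) ` {..<p + q}"
      unfolding image_Un[symmetric] by (rule arg_cong[where f = "image _"]) auto
    finally show ?thesis .
  qed
  note \<sigma>C = this
  have "real (card (C \<inter> star_segment n \<kappa> x y)) = 1 + star_dist \<kappa> x y" if xy: "x \<in> C" "y \<in> C" for x y
  proof -
    obtain k l where k: "k < p + q" "\<sigma> x = r + real k" and l: "l < p + q" "\<sigma> y = r + real l"
      using \<sigma>C xy by blast
    have seg: "z \<in> star_segment n \<kappa> x y \<longleftrightarrow> min (\<sigma> x) (\<sigma> y) \<le> \<sigma> z \<and> \<sigma> z \<le> max (\<sigma> x) (\<sigma> y)" if "z \<in> C" for z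
    proof -
      have "z \<in> star_segment n \<kappa> x y \<longleftrightarrow> \<bar>\<sigma> x - \<sigma> z\<bar> + \<bar>\<sigma> z - \<sigma> y\<bar> = \<bar>\<sigma> x - \<sigma> y\<bar>"
        using that xy C(1) \<kappa> by (subst star_segment_eq) (auto simp: dist)
      then show ?thesis by linarith
    qed
    have "\<sigma> ` (C \<inter> star_segment n \<kappa> x y) = {t \<in> \<sigma> ` C. min (\<sigma> x) (\<sigma> y) \<le> t \<and> t \<le> max (\<sigma> x) (\<sigma> y)}"
      using seg by auto
    \<comment> \<open>Consecutive numbering turns the segment into an integer interval, whose size
      is one more than the distance of its ends.\<close>
    also have "\<dots> = (\<lambda>l. r + real l) ` {min k l..max k l}"
      unfolding \<sigma>C k l using k(1) l(1) by (auto simp: min_def max_def)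
    finally have "card (\<sigma> ` (C \<inter> star_segment n \<kappa> x y)) = card {min k l..max k l}"
      by (simp add: card_image inj_on_def)
    moreover have "card (\<sigma> ` (C \<inter> star_segment n \<kappa> x y)) = card (C \<inter> star_segment n \<kappa> x y)"
      by (rule card_image) (rule inj_on_subset[OF inj], blast)
    moreover have "star_dist \<kappa> x y = \<bar>real k - real l\<bar>"
      using dist[OF xy] k l by simp
    ultimately show ?thesis by (auto simp: min_def max_def)
  qed
  then show ?thesis using C by (auto simp: chain_def)
qed

text \<open>If the governing start is \<open>0\<close>, the centre becomes occupied and every arm
  carries \<open>1, 2, ...\<close>. Otherwise the centre stays free, and the starts of arm
  \<open>m\<close> and of any other occupied arm add up to \<open>1\<close>, so \<open>m\<close>
  governs.\<close>

lemma slide_one_regular: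
  assumes \<kappa>: "0 < \<kappa>" "real (card c) - 1 \<le> \<kappa>" and c: "c \<subseteq> star n" "finite c" "c \<noteq> {}" and n: "2 \<le> n"
  shows "regular n \<kappa> (slide \<kappa> c 1 ` c)"
proof -
  define c' where "c' = slide \<kappa> c 1 ` c"
  have c': "c' \<subseteq> star n" "finite c'"
    using slide_in_star[OF c \<kappa>, of 1] c(2) by (auto simp: c'_def)
  have slide: "slide \<kappa> c 1 y = star_pt (fst y) (target c y / \<kappa>)" for y
    by (simp add: slide_def)
  have fst_slide: "fst (slide \<kappa> c 1 y) = (if target c y = 0 then 0 else fst y)" for y
    using \<kappa> by (simp add: slide star_pt_def)
  have snd_slide: "\<kappa> * snd (slide \<kappa> c 1 y) = target c y" for y
    using \<kappa> by (simp add: slide)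
  define N where "N i = card {y \<in> c. fst y = i}" for i
  define P where "P i = (\<lambda>z. \<kappa> * snd z) ` {z \<in> c'. fst z = i}" for i
  have T: "target c ` {y \<in> c. fst y = i} = (\<lambda>l. arm_start c i + real l) ` {..<N i}" for i
  proof -
    have "target c ` {y \<in> c. fst y = i} = (\<lambda>y. arm_start c i + real (card (below c y))) ` {y \<in> c. fst y = i}"
      by (rule image_cong) (auto simp: target_def)
    also have "\<dots> = (\<lambda>l. arm_start c i + real l) ` (\<lambda>y. card (below c y)) ` {y \<in> c. fst y = i}"
      by (simp add: image_image)
    finally show ?thesis by (simp add: card_below_image[OF c(2)] N_def)
  qed
  \<comment> \<open>A point with target \<open>0\<close> leaves arm \<open>i\<close> for the centre,
    hence the removal of \<open>0\<close>.\<close>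
  have P: "P i = target c ` {y \<in> c. fst y = i} - {0}" if "1 \<le> i" for i
  proof -
    have "{z \<in> c'. fst z = i} = slide \<kappa> c 1 ` {y \<in> c. fst y = i \<and> target c y \<noteq> 0}"
      using that by (auto simp: c'_def fst_slide)
    then have "P i = target c ` {y \<in> c. fst y = i \<and> target c y \<noteq> 0}"
      by (simp add: P_def image_image snd_slide)
    then show ?thesis by auto
  qed
  have c'0: "z = (0, 0)" if "z \<in> c'" "fst z = 0" for z
    using that star_coords[OF subsetD[OF c'(1) that(1)]] by (simp add: prod_eq_iff)
  have arm_c': "arm n \<kappa> i c' = {z \<in> c'. fst z = 0 \<or> fst z = i}" if "i \<in> {1..n}" for i
    using arm_eq[OF \<kappa>(1) c'(1) that] .
  obtain m where m: "m \<in> fst ` c" "0 \<le> arm_start c m" "arm_start c m < 1"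
      "\<And>i. i \<in> fst ` c \<Longrightarrow> i \<noteq> m \<Longrightarrow> arm_start c i = 1 - arm_start c m"
    by (rule arm_start_governed[OF c]) (rule that)
  have "regular n \<kappa> c'"
  proof (cases "arm_start c m = 0")
    case True
    obtain f where f: "f \<in> c" "fst f = m" "\<And>y. y \<in> c \<Longrightarrow> fst y = m \<Longrightarrow> snd f \<le> snd y"
      using arm_first_attained[OF c(2) m(1)] by metis
    have "below c f = {}" using f by (force simp: below_def)
    then have "target c f = 0" using True f(2) by (simp add: target_def)
    then have "slide \<kappa> c 1 f = (0, 0)" by (simp add: slide star_pt_def)
    then have center: "(0, 0) \<in> c'" using f(1) by (force simp: c'_def)
    have Pq: "\<exists>q. P i = (\<lambda>l. 1 + real l) ` {..<q}" if i: "1 \<le> i" for i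
    proof (cases "i \<in> fst ` c")
      case False
      then have none: "{y \<in> c. fst y = i} = {}" by blast
      show ?thesis using P[OF i] unfolding none by (intro exI[of _ 0]) simp
    next
      case I: True
      show ?thesis
      proof (cases "i = m")
        case im: True
        \<comment> \<open>On arm \<open>m\<close> the lowest point has gone to the centre, so the
          remaining ranks begin at \<open>1\<close>.\<close>
        have "P i = real ` {..<N i} - {0}"
          using P[OF i] T[of i] True im by simp
        also have "\<dots> = (\<lambda>l. 1 + real l) ` {..<N i - 1}"
        proof (intro equalityI subsetI)
          fix x assume "x \<in> real ` {..<N i} - {0}"
          then obtain l where "x = real l" "l < N i" "l \<noteq> 0" by auto
          then show "x \<in> (\<lambda>l. 1 + real l) ` {..<N i - 1}"
            by (intro image_eqI[of _ _ "l - 1"]) (auto simp: of_nat_diff)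
        next
          fix x assume "x \<in> (\<lambda>l. 1 + real l) ` {..<N i - 1}"
          then obtain l where "x = 1 + real l" "l < N i - 1" by auto
          then show "x \<in> real ` {..<N i} - {0}"
            by (auto intro!: image_eqI[of _ _ "l + 1"])
        qed
        finally show ?thesis by blast
      next
        case False
        then have "arm_start c i = 1" using m(4)[OF I] True by simp
        then have "P i = (\<lambda>l. 1 + real l) ` {..<N i} - {0}" using P[OF i] T[of i] by simp
        moreover have "0 \<notin> (\<lambda>l. 1 + real l) ` {..<N i}" by auto
        ultimately show ?thesis by simp blast
      qed
    qed
    then obtain q where q: "\<And>i. 1 \<le> i \<Longrightarrow> P i = (\<lambda>l. 1 + real l) ` {..<q i}" by metis
    \<comment> \<open>With the centre occupied any arm governs; \<open>1\<close> is chosen. The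
      centre is counted on the side of arm \<open>i\<close>, hence \<open>a = 0\<close> and
      \<open>Suc (q i)\<close>; arm \<open>1\<close> fills the negative side unless
      \<open>i = 1\<close>.\<close>
    have chains: "chain n \<kappa> (arm n \<kappa> 1 c' \<union> arm n \<kappa> i c')" if i: "i \<in> {1..n}" for i
    proof (rule chainI[OF \<kappa>(1), where a = 0 and i = i and m = 1 and p = "Suc (q i)" and q = "if i = 1 then 0 else q 1"])
      let ?C = "arm n \<kappa> 1 c' \<union> arm n \<kappa> i c'"
      have C: "?C = {z \<in> c'. fst z = 0 \<or> fst z = 1 \<or> fst z = i}"
        using arm_c'[of 1] arm_c'[OF i] n by auto
      show "?C \<subseteq> star n" "finite ?C" using c' C by auto
      show "fst z = 0 \<or> fst z = i \<or> fst z = 1" if "z \<in> ?C" for z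
        using that unfolding C by auto
      have "{z \<in> ?C. fst z = 0 \<or> fst z = i} = insert (0, 0) {z \<in> c'. fst z = i}"
      proof (rule set_eqI)
        show "z \<in> {z \<in> ?C. fst z = 0 \<or> fst z = i} \<longleftrightarrow> z \<in> insert (0, 0) {z \<in> c'. fst z = i}" for z
          unfolding C using c'0[of z] center by auto
      qed
      then have "(\<lambda>z. \<kappa> * snd z) ` {z \<in> ?C. fst z = 0 \<or> fst z = i} = insert 0 (P i)"
        by (simp add: P_def)
      also have "\<dots> = (\<lambda>l. 0 + real l) ` {..<Suc (q i)}"
        using q[of i] i by (simp add: lessThan_Suc_eq_insert_0 image_image)
      finally show "(\<lambda>z. \<kappa> * snd z) ` {z \<in> ?C. fst z = 0 \<or> fst z = i} = (\<lambda>l. 0 + real l) ` {..<Suc (q i)}" .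
      have "{z \<in> ?C. fst z \<noteq> 0 \<and> fst z \<noteq> i} = (if i = 1 then {} else {z \<in> c'. fst z = 1})"
        unfolding C using i by auto
      then show "(\<lambda>z. \<kappa> * snd z) ` {z \<in> ?C. fst z \<noteq> 0 \<and> fst z \<noteq> i}
          = (\<lambda>l. 1 - 0 + real l) ` {..<if i = 1 then 0 else q 1}"
        using q[of 1] by (simp add: P_def)
    qed
    have "arm n \<kappa> i c' \<noteq> {}" if "i \<in> {1..n}" for i
      using arm_c'[OF that] center by auto
    then have "{i \<in> {1..n}. arm n \<kappa> i c' \<noteq> {}} = {1..n}" "arm n \<kappa> 1 c' \<noteq> {}"
      using n by auto
    moreover have "1 \<in> {1..n}" "2 \<le> card {1..n}" using n by auto
    ultimately show ?thesis
      unfolding regular_def using chains by metis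
  next
    case False
    have pos: "0 < arm_start c i" if "i \<in> fst ` c" for i
      using False m(2,3) m(4)[OF that] by (cases "i = m") auto
    then have tpos: "0 < target c y" if "y \<in> c" for y
      using that by (simp add: target_def add_pos_nonneg)
    have I0: "0 \<notin> fst ` c"
      using tpos target_center[OF c] by force
    have I: "fst ` c \<subseteq> {1..n}"
    proof (rule image_subsetI)
      fix y assume "y \<in> c"
      then have "y \<in> star n" "fst y \<noteq> 0" using c(1) I0 by (blast, metis imageI)
      then show "fst y \<in> {1..n}" by (auto simp: star_def)
    qed
    have no: "fst z \<noteq> 0" if "z \<in> c'" for z
    proof -
      obtain y where y: "y \<in> c" "z = slide \<kappa> c 1 y" using \<open>z \<in> c'\<close> unfolding c'_def by blast
      have "fst y \<noteq> 0" using I0 imageI[OF y(1), of fst] by metis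
      then show ?thesis using tpos[OF y(1)] y(2) by (simp add: fst_slide)
    qed
    have fst_c': "fst ` c' = fst ` c"
      unfolding c'_def image_image
    proof (intro image_cong refl)
      show "fst (slide \<kappa> c 1 y) = fst y" if "y \<in> c" for y
        using tpos[OF that] by (simp add: fst_slide)
    qed
    have Pi: "P i = (\<lambda>l. arm_start c i + real l) ` {..<N i}" if "1 \<le> i" for i
    proof -
      have "0 \<notin> target c ` {y \<in> c. fst y = i}" 
      proof
        assume "0 \<in> target c ` {y \<in> c. fst y = i}"
        then obtain y where "y \<in> c" "0 = target c y" by blast
        then show False using tpos[of y] by simp
      qed
      then show ?thesis using P[OF that] T[of i] by simp
    qed
    \<comment> \<open>Arm \<open>i\<close> is the positive side and arm \<open>m\<close> the
      negative one, as \<open>1 - arm_start c i = arm_start c m\<close>. If \<open>i\<close> is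
      \<open>m\<close> or an empty arm, only arm \<open>m\<close> is left and the negative side is
      empty.\<close>
    have chains: "chain n \<kappa> (arm n \<kappa> m c' \<union> arm n \<kappa> i c')" if i: "i \<in> {1..n}" for i
    proof -
      let ?C = "arm n \<kappa> m c' \<union> arm n \<kappa> i c'"
      have C: "?C = {z \<in> c'. fst z = m \<or> fst z = i}"
      proof (rule set_eqI)
        show "z \<in> ?C \<longleftrightarrow> z \<in> {z \<in> c'. fst z = m \<or> fst z = i}" for z
          unfolding arm_c'[OF subsetD[OF I m(1)]] arm_c'[OF i] using no[of z] by auto
      qed
      have C': "?C \<subseteq> star n" "finite ?C" using c' C by auto
      show ?thesis
      proof (cases "i \<in> fst ` c \<and> i \<noteq> m")
        case True
        show ?thesis
        proof (rule chainI[OF \<kappa>(1) C', where a = "arm_start c i" and i = i and m = m and p = "N i" and q = "N m"])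
          have e: "{z \<in> ?C. fst z = 0 \<or> fst z = i} = {z \<in> c'. fst z = i}"
            unfolding C by (rule Collect_cong) (use no in blast)
          show "(\<lambda>z. \<kappa> * snd z) ` {z \<in> ?C. fst z = 0 \<or> fst z = i} = (\<lambda>l. arm_start c i + real l) ` {..<N i}"
            unfolding e P_def[symmetric] using Pi i by simp
          have e: "{z \<in> ?C. fst z \<noteq> 0 \<and> fst z \<noteq> i} = {z \<in> c'. fst z = m}"
            unfolding C by (rule Collect_cong) (use no True in blast)
          have "1 - arm_start c i = arm_start c m" "1 \<le> m"
            using m(4)[of i] True subsetD[OF I m(1)] by simp_all
          then show "(\<lambda>z. \<kappa> * snd z) ` {z \<in> ?C. fst z \<noteq> 0 \<and> fst z \<noteq> i} = (\<lambda>l. 1 - arm_start c i + real l) ` {..<N m}"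
            unfolding e P_def[symmetric] using Pi[of m] by simp
        qed (unfold C, auto)
      next
        case F: False
        show ?thesis
        proof (rule chainI[OF \<kappa>(1) C', where a = "arm_start c m" and i = m and m = i and p = "N m" and q = 0])
          have e: "{z \<in> ?C. fst z = 0 \<or> fst z = m} = {z \<in> c'. fst z = m}"
            unfolding C by (rule Collect_cong) (use no in blast)
          show "(\<lambda>z. \<kappa> * snd z) ` {z \<in> ?C. fst z = 0 \<or> fst z = m} = (\<lambda>l. arm_start c m + real l) ` {..<N m}"
            unfolding e P_def[symmetric] using Pi subsetD[OF I m(1)] by simp
          have "fst z = m \<or> fst z \<noteq> i" if "z \<in> c'" for z
            using F imageI[OF that, of fst] unfolding fst_c' by metis
          then have e: "{z \<in> ?C. fst z \<noteq> 0 \<and> fst z \<noteq> m} = {}"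
            unfolding C by blast
          show "(\<lambda>z. \<kappa> * snd z) ` {z \<in> ?C. fst z \<noteq> 0 \<and> fst z \<noteq> m} = (\<lambda>l. 1 - arm_start c m + real l) ` {..<0}"
            unfolding e by simp
        qed (unfold C, auto)
      qed
    qed
    have nonempty: "arm n \<kappa> i c' \<noteq> {}" if occ: "i \<in> fst ` c" for i
    proof -
      obtain z where "z \<in> c'" "fst z = i" using occ unfolding fst_c'[symmetric] by blast
      then show ?thesis using arm_c'[OF subsetD[OF I occ]] by blast
    qed
    \<comment> \<open>A lone arm would start at \<open>0\<close>, the case already treated.\<close>
    have "fst ` c \<noteq> {m}"
      using False start_singleton[of "lead c" m] by auto
    then obtain j where j: "j \<in> fst ` c" "j \<noteq> m" using m(1) by blast
    have "card {j, m} \<le> card {i \<in> {1..n}. arm n \<kappa> i c' \<noteq> {}}"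
    proof (rule card_mono)
      show "{j, m} \<subseteq> {i \<in> {1..n}. arm n \<kappa> i c' \<noteq> {}}"
        using nonempty[OF j(1)] nonempty[OF m(1)] subsetD[OF I j(1)] subsetD[OF I m(1)] by blast
    qed simp
    then have "2 \<le> card {i \<in> {1..n}. arm n \<kappa> i c' \<noteq> {}}" using j(2) by simp
    then show ?thesis
      unfolding regular_def using chains nonempty[OF m(1)] subsetD[OF I m(1)]
      by (intro conjI bexI[of _ m] ballI) simp_all
  qed
  then show ?thesis by (simp add: c'_def)
qed

section \<open>Continuity\<close>

text \<open>The functions \<open>height a\<close> for \<open>a \<in> {1..n}\<close> embed the star into a power of the real line, which
  turns limits in the star into limits of real functions.\<close>

definition height :: "nat \<Rightarrow> star_point \<Rightarrow> real" where
  "height a y = (if fst y = a then snd y else 0)"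

lemma height_sum:
  assumes "y \<in> star n"
  shows "snd y = (\<Sum>a\<in>{1..n}. height a y)"
  using assms by (auto simp: height_def star_def)

text \<open>In these coordinates the star metric is the l1 metric: points of different arms have
  disjoint supports, so their heights add.\<close>

lemma star_simplicial_dist_height:
  assumes "x \<in> star n" "y \<in> star n"
  shows "star_simplicial_dist x y = (\<Sum>a\<in>{1..n}. \<bar>height a x - height a y\<bar>)"
proof (cases "fst x = fst y")
  case True
  have "(\<Sum>a\<in>{1..n}. \<bar>height a x - height a y\<bar>) = (\<Sum>a\<in>{1..n}. if a = fst x then \<bar>snd x - snd y\<bar> else 0)"
    using True by (intro sum.cong) (auto simp: height_def)
  also have "\<dots> = \<bar>snd x - snd y\<bar>"
    using assms True by (auto simp: star_def)
  finally show ?thesis using True by (simp add: star_simplicial_dist_def)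
next
  case False
  have "(\<Sum>a\<in>{1..n}. \<bar>height a x - height a y\<bar>)
      = (\<Sum>a\<in>{1..n}. (if a = fst x then \<bar>snd x\<bar> else 0) + (if a = fst y then \<bar>snd y\<bar> else 0))"
    using False by (intro sum.cong) (auto simp: height_def)
  also have "\<dots> = (\<Sum>a\<in>{1..n}. if a = fst x then \<bar>snd x\<bar> else 0) + (\<Sum>a\<in>{1..n}. if a = fst y then \<bar>snd y\<bar> else 0)"
    by (rule sum.distrib)
  also have "\<dots> = \<bar>snd x\<bar> + \<bar>snd y\<bar>"
    using assms by (auto simp: star_def)
  finally show ?thesis using False by (simp add: star_simplicial_dist_def)
qed

lemma topspace_star_topology: "0 < \<kappa> \<Longrightarrow> topspace (star_topology n \<kappa>) = star n"
  unfolding star_topology_def by (rule Metric_space.topspace_mtopology[OF Metric_space_star])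

lemma limitin_star:
  assumes \<kappa>: "0 < \<kappa>"
  shows "limitin (star_topology n \<kappa>) f l F \<longleftrightarrow>
    l \<in> star n \<and> (\<forall>\<^sub>F z in F. f z \<in> star n) \<and> (\<forall>a\<in>{1..n}. ((\<lambda>z. height a (f z)) \<longlongrightarrow> height a l) F)"
proof -
  interpret Metric_space "star n" "star_dist \<kappa>" by (rule Metric_space_star[OF \<kappa>])
  have "((\<lambda>z. star_dist \<kappa> (f z) l) \<longlongrightarrow> 0) F \<longleftrightarrow> (\<forall>a\<in>{1..n}. ((\<lambda>z. height a (f z)) \<longlongrightarrow> height a l) F)"
    if l: "l \<in> star n" and f: "\<forall>\<^sub>F z in F. f z \<in> star n"
  proof -
    have dist: "\<forall>\<^sub>F z in F. star_dist \<kappa> (f z) l = \<kappa> * (\<Sum>a\<in>{1..n}. \<bar>height a (f z) - height a l\<bar>)"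
      using f by eventually_elim (simp add: star_dist_def star_simplicial_dist_height[OF _ l])
    show ?thesis
    proof
      assume lim: "((\<lambda>z. star_dist \<kappa> (f z) l) \<longlongrightarrow> 0) F"
      show "\<forall>a\<in>{1..n}. ((\<lambda>z. height a (f z)) \<longlongrightarrow> height a l) F"
      proof
        fix a assume a: "a \<in> {1..n}"
        have "((\<lambda>z. height a (f z) - height a l) \<longlongrightarrow> 0) F"
        proof (rule Lim_null_comparison)
          show "\<forall>\<^sub>F z in F. norm (height a (f z) - height a l) \<le> star_dist \<kappa> (f z) l / \<kappa>"
            using dist
          proof eventually_elim
            case (elim z)
            have "\<bar>height a (f z) - height a l\<bar> \<le> (\<Sum>a\<in>{1..n}. \<bar>height a (f z) - height a l\<bar>)"
              using a by (intro member_le_sum) auto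
            then show ?case using elim \<kappa> by simp
          qed
          show "((\<lambda>z. star_dist \<kappa> (f z) l / \<kappa>) \<longlongrightarrow> 0) F"
            using tendsto_divide[OF lim tendsto_const[of \<kappa>]] \<kappa> by simp
        qed
        then show "((\<lambda>z. height a (f z)) \<longlongrightarrow> height a l) F" by (rule LIM_zero_cancel)
      qed
    next
      assume lim: "\<forall>a\<in>{1..n}. ((\<lambda>z. height a (f z)) \<longlongrightarrow> height a l) F"
      have "((\<lambda>z. \<kappa> * (\<Sum>a\<in>{1..n}. \<bar>height a (f z) - height a l\<bar>)) \<longlongrightarrow> \<kappa> * (\<Sum>a\<in>{1..n}. \<bar>height a l - height a l\<bar>)) F"
        using lim by (intro tendsto_intros tendsto_sum) auto
      then show "((\<lambda>z. star_dist \<kappa> (f z) l) \<longlongrightarrow> 0) F"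
        using tendsto_cong[OF dist] by simp
    qed
  qed
  then show ?thesis
    unfolding star_topology_def limitin_metric_dist_null by blast
qed

section \<open>Convergence of the targets\<close>

lemma tendsto_if_eventually:
  fixes f :: "'a \<Rightarrow> real"
  assumes "\<forall>\<^sub>F z in F. g z = c" "(f \<longlongrightarrow> L) F"
  shows "((\<lambda>z. if g z = a then f z else 0) \<longlongrightarrow> (if c = a then L else 0)) F"
proof (rule Lim_transform_eventually)
  show "((\<lambda>z. if c = a then f z else 0) \<longlongrightarrow> (if c = a then L else 0)) F"
    using assms(2) by simp
  show "\<forall>\<^sub>F z in F. (if c = a then f z else 0) = (if g z = a then f z else 0)"
    using assms(1) by eventually_elim simp
qed

context
  fixes n k :: nat and x :: "nat \<Rightarrow> star_point"
  assumes x: "x ` {..<k} \<subseteq> star n" "inj_on x {..<k}"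
begin

lemma card_below_conf:
  assumes "l < k"
  shows "card (below (x ` {..<k}) (x l)) = card {l' \<in> {..<k}. fst (x l') = fst (x l) \<and> snd (x l') < snd (x l)}"
proof -
  have "below (x ` {..<k}) (x l) = x ` {l' \<in> {..<k}. fst (x l') = fst (x l) \<and> snd (x l') < snd (x l)}"
    by (auto simp: below_def)
  then show ?thesis
    using inj_on_subset[OF x(2)] by (simp add: card_image subset_iff)
qed

text \<open>The count leaves out \<open>l0\<close>, so up to a small error the other targets do not
  depend on the arm from which \<open>x l0\<close> approaches the centre.\<close>

lemma target_near_center:
  assumes l0: "l0 < k" "snd (x l0) < \<eta>" and \<eta>: "0 < \<eta>"
    and far: "\<And>l. l < k \<Longrightarrow> l \<noteq> l0 \<Longrightarrow> \<eta> \<le> snd (x l)"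
  shows "\<bar>target (x ` {..<k}) (x l0)\<bar> \<le> 2 * snd (x l0) / \<eta>"
    and "\<And>l. l < k \<Longrightarrow> l \<noteq> l0 \<Longrightarrow>
      \<bar>target (x ` {..<k}) (x l)
        - (1 + card {l' \<in> {..<k} - {l0}. fst (x l') = fst (x l) \<and> snd (x l') < snd (x l)})\<bar> \<le> 2 * snd (x l0) / \<eta>"
proof -
  let ?c = "x ` {..<k}"
  have c: "?c \<subseteq> star n" "finite ?c" "?c \<noteq> {}" using x l0 by auto
  have "\<eta> \<le> snd z" if "z \<in> ?c" "z \<noteq> x l0" for z
    using that far by auto
  note near = arm_start_near[OF c imageI order.refl \<eta> this l0(2)]
  have "\<not> snd (x l) < snd (x l0)" if "l < k" for l
    using far[OF that] l0(2) by (cases "l = l0") auto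
  then have b0: "below ?c (x l0) = {}"
    unfolding below_def by blast
  show "\<bar>target ?c (x l0)\<bar> \<le> 2 * snd (x l0) / \<eta>"
    using near(1) l0(1) b0 by (simp add: target_def)
  fix l assume l: "l < k" "l \<noteq> l0"
  let ?B = "{l' \<in> {..<k} - {l0}. fst (x l') = fst (x l) \<and> snd (x l') < snd (x l)}"
  have lt: "snd (x l0) < snd (x l)" using far[OF l] l0 by simp
  \<comment> \<open>On the arm of \<open>x l0\<close> this point counts as the extra \<open>1\<close> and the start is close to \<open>0\<close>; on the
    other arms the start itself is close to \<open>1\<close>.\<close>
  show "\<bar>target ?c (x l) - (1 + card ?B)\<bar> \<le> 2 * snd (x l0) / \<eta>"
  proof (cases "fst (x l0) = fst (x l)")
    case True
    have "{l' \<in> {..<k}. fst (x l') = fst (x l) \<and> snd (x l') < snd (x l)} = insert l0 ?B"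
      using True lt l0 by auto
    then have "card (below ?c (x l)) = Suc (card ?B)"
      using card_below_conf[OF l(1)] by simp
    then show ?thesis using near(1) l0(1) True by (simp add: target_def)
  next
    case False
    have "{l' \<in> {..<k}. fst (x l') = fst (x l) \<and> snd (x l') < snd (x l)} = ?B"
      using False by auto
    then have "card (below ?c (x l)) = card ?B"
      using card_below_conf[OF l(1)] by simp
    then show ?thesis using near(2)[of "fst (x l)"] l l0(1) False by (simp add: target_def)
  qed
qed

lemma arm_first_conf:
  "arm_first (x ` {..<k}) i = Min ((\<lambda>l. snd (x l)) ` {l \<in> {..<k}. fst (x l) = i})"
proof -
  have "{y \<in> x ` {..<k}. fst y = i} = x ` {l \<in> {..<k}. fst (x l) = i}" by auto
  then show ?thesis by (simp add: arm_first_def image_image)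
qed

end

context
  fixes n k :: nat and X :: "'z \<Rightarrow> nat \<Rightarrow> star_point" and x :: "nat \<Rightarrow> star_point" and F :: "'z filter"
  assumes X: "\<forall>\<^sub>F z in F. X z ` {..<k} \<subseteq> star n \<and> inj_on (X z) {..<k}"
    and x: "x ` {..<k} \<subseteq> star n" "inj_on x {..<k}"
    and lim: "\<And>l a. l < k \<Longrightarrow> a \<in> {1..n} \<Longrightarrow> ((\<lambda>z. height a (X z l)) \<longlongrightarrow> height a (x l)) F"
begin

lemma tendsto_snd: "l < k \<Longrightarrow> ((\<lambda>z. snd (X z l)) \<longlongrightarrow> snd (x l)) F"
proof -
  assume l: "l < k"
  have ev: "\<forall>\<^sub>F z in F. (\<Sum>a\<in>{1..n}. height a (X z l)) = snd (X z l)"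
    using X
  proof eventually_elim
    case (elim z)
    then have "X z l \<in> star n" using l by blast
    then show ?case by (rule height_sum[symmetric])
  qed
  have "((\<lambda>z. \<Sum>a\<in>{1..n}. height a (X z l)) \<longlongrightarrow> (\<Sum>a\<in>{1..n}. height a (x l))) F"
    using lim l by (intro tendsto_sum) auto
  moreover have "x l \<in> star n" using x(1) l by blast
  ultimately have "((\<lambda>z. \<Sum>a\<in>{1..n}. height a (X z l)) \<longlongrightarrow> snd (x l)) F"
    by (simp only: height_sum)
  then show ?thesis using ev by (rule Lim_transform_eventually)
qed

lemma eventually_same_fst:
  assumes "l < k" "0 < snd (x l)"
  shows "\<forall>\<^sub>F z in F. fst (X z l) = fst (x l)"
proof -
  have xl: "x l \<in> star n" using x(1) assms(1) by blast
  then have "fst (x l) \<in> {1..n}" using assms(2) by (auto simp: star_def)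
  then have "((\<lambda>z. height (fst (x l)) (X z l)) \<longlongrightarrow> snd (x l)) F"
    using lim[OF assms(1)] by (force simp: height_def)
  then have "\<forall>\<^sub>F z in F. 0 < height (fst (x l)) (X z l)"
    using assms(2) by (rule order_tendstoD)
  then show ?thesis
    by eventually_elim (auto simp: height_def split: if_splits)
qed

text \<open>Distinct points on an arm have distinct heights, so strict inequalities in the limit
  persist nearby. Restricting to \<open>J\<close> allows a point converging to the centre to be left
  out.\<close>

lemma eventually_same_order:
  assumes J: "J \<subseteq> {..<k}" "\<And>l. l \<in> J \<Longrightarrow> 0 < snd (x l)"
  shows "\<forall>\<^sub>F z in F. (\<forall>l\<in>J. fst (X z l) = fst (x l)) \<and>
    (\<forall>l\<in>J. \<forall>l'\<in>J. fst (x l') = fst (x l) \<longrightarrow> (snd (X z l') < snd (X z l) \<longleftrightarrow> snd (x l') < snd (x l)))"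
proof -
  have fin: "finite J" using J(1) finite_subset by blast
  have less: "\<forall>\<^sub>F z in F. snd (X z l) < snd (X z l')" if "l \<in> J" "l' \<in> J" "snd (x l) < snd (x l')" for l l'
  proof -
    have "((\<lambda>z. snd (X z l') - snd (X z l)) \<longlongrightarrow> snd (x l') - snd (x l)) F"
      using that J(1) by (intro tendsto_diff tendsto_snd) auto
    then have "\<forall>\<^sub>F z in F. 0 < snd (X z l') - snd (X z l)"
      using that(3) by (intro order_tendstoD) auto
    then show ?thesis by eventually_elim simp
  qed
  have "\<forall>\<^sub>F z in F. snd (X z l') < snd (X z l) \<longleftrightarrow> snd (x l') < snd (x l)"
    if l: "l \<in> J" "l' \<in> J" "fst (x l') = fst (x l)" for l l'
  proof (cases "snd (x l)" "snd (x l')" rule: linorder_cases)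
    case less
    then show ?thesis
      using \<open>\<lbrakk>l \<in> J; l' \<in> J; snd (x l) < snd (x l')\<rbrakk> \<Longrightarrow> \<forall>\<^sub>F z in F. snd (X z l) < snd (X z l')\<close> l
      by (auto elim!: eventually_mono)
  next
    case equal
    then have "l = l'" using l J(1) x(2) by (metis inj_onD prod_eq_iff subsetD)
    then show ?thesis by simp
  next
    case greater
    then show ?thesis using less[of l' l] l by (auto elim!: eventually_mono)
  qed
  then have "\<forall>\<^sub>F z in F. \<forall>l\<in>J. \<forall>l'\<in>J. fst (x l') = fst (x l) \<longrightarrow> (snd (X z l') < snd (X z l) \<longleftrightarrow> snd (x l') < snd (x l))"
    using fin by (simp add: eventually_ball_finite)
  moreover have "\<forall>\<^sub>F z in F. \<forall>l\<in>J. fst (X z l) = fst (x l)"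
    using fin J eventually_same_fst by (intro eventually_ball_finite) auto
  ultimately show ?thesis by eventually_elim blast
qed

text \<open>Away from the centre the arms and ranks are eventually constant, so only the starts
  vary, and these depend continuously on the first heights.\<close>

lemma tendsto_target_off_center:
  assumes l: "l < k" and off: "(0, 0) \<notin> x ` {..<k}"
  shows "((\<lambda>z. target (X z ` {..<k}) (X z l)) \<longlongrightarrow> target (x ` {..<k}) (x l)) F"
proof -
  let ?c = "x ` {..<k}"
  let ?I = "fst ` ?c"
  have pos: "0 < snd (x l)" if "l < k" for l
  proof -
    have "x l \<in> x ` {..<k}" using that by simp
    then have "x l \<in> star n" "x l \<noteq> (0, 0)" using subsetD[OF x(1)] off by metis+
    then show ?thesis by (auto simp: star_def)
  qed
  define B where "B = card {l' \<in> {..<k}. fst (x l') = fst (x l) \<and> snd (x l') < snd (x l)}"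
  have same: "\<forall>\<^sub>F z in F. (\<forall>l\<in>{..<k}. fst (X z l) = fst (x l)) \<and>
    (\<forall>l\<in>{..<k}. \<forall>l'\<in>{..<k}. fst (x l') = fst (x l) \<longrightarrow> (snd (X z l') < snd (X z l) \<longleftrightarrow> snd (x l') < snd (x l)))"
    using pos by (intro eventually_same_order) auto
  have ev: "\<forall>\<^sub>F z in F. start (lead (X z ` {..<k})) ?I (fst (x l)) + B = target (X z ` {..<k}) (X z l)"
    using same X
  proof eventually_elim
    case (elim z)
    have "fst ` X z ` {..<k} = ?I" using elim by (simp add: image_image)
    moreover have "card (below (X z ` {..<k}) (X z l)) = B"
      unfolding card_below_conf[OF conjunct1[OF elim(2)] conjunct2[OF elim(2)] l] B_def
      using elim(1) l by (intro arg_cong[where f = card]) auto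
    ultimately show ?case using elim l by (simp add: target_def)
  qed
  have first: "((\<lambda>z. arm_first (X z ` {..<k}) i) \<longlongrightarrow> arm_first ?c i) F" if i: "i \<in> ?I" for i
  proof -
    let ?L = "{l \<in> {..<k}. fst (x l) = i}"
    have "((\<lambda>z. Min ((\<lambda>l. snd (X z l)) ` ?L)) \<longlongrightarrow> Min ((\<lambda>l. snd (x l)) ` ?L)) F"
      using i by (intro tendsto_Min_image tendsto_snd) auto
    moreover have "\<forall>\<^sub>F z in F. Min ((\<lambda>l. snd (X z l)) ` ?L) = arm_first (X z ` {..<k}) i"
      using same X
    proof eventually_elim
      case (elim z)
      have "?L = {l \<in> {..<k}. fst (X z l) = i}" using elim by auto
      then show ?case using arm_first_conf[OF conjunct1[OF elim(2)] conjunct2[OF elim(2)], of i] by simp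
    qed
    ultimately show ?thesis
      unfolding arm_first_conf[OF x] by (rule Lim_transform_eventually)
  qed
  have "((\<lambda>z. start (lead (X z ` {..<k})) ?I (fst (x l)) + B) \<longlongrightarrow> arm_start ?c (fst (x l)) + B) F"
  proof (intro tendsto_add tendsto_const tendsto_start)
    show "((\<lambda>z. lead (X z ` {..<k}) i j) \<longlongrightarrow> lead ?c i j) F" if ij: "i \<in> ?I" "j \<in> ?I" "i \<noteq> j" for i j
    proof -
      have c: "?c \<subseteq> star n" "finite ?c" "?c \<noteq> {}" using x(1) l by auto
      \<comment> \<open>Two different arms cannot both have first height \<open>0\<close>, so the
        denominator of the limiting lead does not vanish.\<close>
      have "arm_first ?c i + arm_first ?c j \<noteq> 0"
        using arm_first_nonneg[OF c ij(1)] arm_first_nonneg[OF c ij(2)] ij(3) by auto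
      then show ?thesis
        unfolding lead_def using ij by (intro tendsto_intros first)
    qed
  qed (use l in auto)
  moreover have "arm_start ?c (fst (x l)) + B = target ?c (x l)"
    unfolding target_def card_below_conf[OF x l] B_def ..
  ultimately show ?thesis
    using Lim_transform_eventually[OF _ ev] by simp
qed

text \<open>The point \<open>l0\<close> may switch arms while approaching the centre, so its arm
  index need not converge. Its target tends to \<open>0\<close>, so its contribution to arm
  \<open>a\<close> converges all the same.\<close>

lemma tendsto_target_center:
  assumes l0: "l0 < k" "x l0 = (0, 0)" and l: "l < k" and a: "a \<in> {1..n}"
  shows "((\<lambda>z. if fst (X z l) = a then target (X z ` {..<k}) (X z l) else 0)
    \<longlongrightarrow> (if fst (x l) = a then target (x ` {..<k}) (x l) else 0)) F"
proof -
  let ?J = "{..<k} - {l0}"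
  have pos: "0 < snd (x l)" if "l \<in> ?J" for l
  proof -
    have "x l \<in> star n" using that x(1) by blast
    moreover have "x l \<noteq> (0, 0)" using that l0 inj_onD[OF x(2), of l l0] by auto
    ultimately have "x l \<in> star n" "x l \<noteq> (0, 0)" .
    then show ?thesis by (auto simp: star_def)
  qed
  \<comment> \<open>Half the least height of the other points in the limit (capped by
    \<open>1\<close>), so that they stay above \<open>\<eta>\<close> in nearby
    configurations.\<close>
  define \<eta> where "\<eta> = Min (insert 1 ((\<lambda>l. snd (x l)) ` ?J)) / 2"
  have \<eta>: "0 < \<eta>" using pos by (auto simp: \<eta>_def)
  have far: "2 * \<eta> \<le> snd (x l)" if "l \<in> ?J" for l
    using that by (simp add: \<eta>_def)
  have far': "\<forall>\<^sub>F z in F. \<forall>l\<in>?J. \<eta> \<le> snd (X z l)"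
  proof (intro eventually_ball_finite ballI)
    fix l assume l: "l \<in> ?J"
    have "\<eta> < snd (x l)" using far[OF l] \<eta> by simp
    then have "\<forall>\<^sub>F z in F. \<eta> < snd (X z l)"
      using tendsto_snd l by (intro order_tendstoD) auto
    then show "\<forall>\<^sub>F z in F. \<eta> \<le> snd (X z l)" by eventually_elim simp
  qed simp
  have lim0: "((\<lambda>z. snd (X z l0)) \<longlongrightarrow> 0) F" using tendsto_snd[OF l0(1)] l0(2) by simp
  then have small: "\<forall>\<^sub>F z in F. snd (X z l0) < \<eta>" using \<eta> by (rule order_tendstoD)
  have bound0: "((\<lambda>z. 2 * snd (X z l0) / \<eta>) \<longlongrightarrow> 0) F"
    using tendsto_divide[OF tendsto_mult[OF tendsto_const[of 2] lim0] tendsto_const[of \<eta>]] \<eta> by simp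
  have same: "\<forall>\<^sub>F z in F. (\<forall>l\<in>?J. fst (X z l) = fst (x l)) \<and>
    (\<forall>l\<in>?J. \<forall>l'\<in>?J. fst (x l') = fst (x l) \<longrightarrow> (snd (X z l') < snd (X z l) \<longleftrightarrow> snd (x l') < snd (x l)))"
    using pos by (intro eventually_same_order) auto
  have farx: "\<eta> \<le> snd (x l)" if "l < k" "l \<noteq> l0" for l
    using far[of l] \<eta> that by simp
  have small0: "snd (x l0) < \<eta>" using \<eta> l0(2) by simp
  show ?thesis
  proof (cases "l = l0")
    case True
    have "((\<lambda>z. if fst (X z l) = a then target (X z ` {..<k}) (X z l) else 0) \<longlongrightarrow> 0) F"
    proof (rule Lim_null_comparison[OF _ bound0])
      show "\<forall>\<^sub>F z in F. norm (if fst (X z l) = a then target (X z ` {..<k}) (X z l) else 0) \<le> 2 * snd (X z l0) / \<eta>"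
        using X far' small
      proof eventually_elim
        case (elim z)
        have "\<bar>target (X z ` {..<k}) (X z l0)\<bar> \<le> 2 * snd (X z l0) / \<eta>"
          using elim by (intro target_near_center(1)[OF conjunct1 conjunct2 l0(1) _ \<eta>]) auto
        then show ?case using True by auto
      qed
    qed
    then show ?thesis using True l0(2) a by simp
  next
    case False
    define B where "B = card {l' \<in> ?J. fst (x l') = fst (x l) \<and> snd (x l') < snd (x l)}"
    have tx: "target (x ` {..<k}) (x l) = 1 + B"
      using target_near_center(2)[OF x l0(1) small0 \<eta> farx l False] l0(2) by (simp add: B_def)
    have "((\<lambda>z. target (X z ` {..<k}) (X z l) - (1 + B)) \<longlongrightarrow> 0) F"
    proof (rule Lim_null_comparison[OF _ bound0])
      show "\<forall>\<^sub>F z in F. norm (target (X z ` {..<k}) (X z l) - (1 + B)) \<le> 2 * snd (X z l0) / \<eta>"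
        using X far' small same
      proof eventually_elim
        case (elim z)
        have "{l' \<in> ?J. fst (X z l') = fst (X z l) \<and> snd (X z l') < snd (X z l)}
            = {l' \<in> ?J. fst (x l') = fst (x l) \<and> snd (x l') < snd (x l)}"
          using elim(4) l False by auto
        moreover have "\<bar>target (X z ` {..<k}) (X z l)
          - (1 + card {l' \<in> ?J. fst (X z l') = fst (X z l) \<and> snd (X z l') < snd (X z l)})\<bar> \<le> 2 * snd (X z l0) / \<eta>"
          using elim l False by (intro target_near_center(2)[OF conjunct1 conjunct2 l0(1) _ \<eta>]) auto
        ultimately show ?case by (simp add: B_def)
      qed
    qed
    then have "((\<lambda>z. target (X z ` {..<k}) (X z l)) \<longlongrightarrow> target (x ` {..<k}) (x l)) F"
      unfolding tx by (rule LIM_zero_cancel)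
    moreover have "\<forall>\<^sub>F z in F. fst (X z l) = fst (x l)"
      using same by eventually_elim (use l False in auto)
    ultimately show ?thesis by (intro tendsto_if_eventually)
  qed
qed

text \<open>The guard \<open>fst (X z l) = a\<close> makes this the \<open>a\<close>-th coordinate
  of the target position, the form in which targets enter \<open>height_slide\<close>.\<close>

lemma tendsto_target:
  assumes l: "l < k" and a: "a \<in> {1..n}"
  shows "((\<lambda>z. if fst (X z l) = a then target (X z ` {..<k}) (X z l) else 0)
    \<longlongrightarrow> (if fst (x l) = a then target (x ` {..<k}) (x l) else 0)) F"
proof (cases "(0, 0) \<in> x ` {..<k}")
  case True
  then obtain l0 where "l0 < k" "x l0 = (0, 0)" by auto
  then show ?thesis using tendsto_target_center l a by blast
next
  case False
  have "x l \<in> x ` {..<k}" using l by simp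
  then have "x l \<in> star n" "x l \<noteq> (0, 0)" using subsetD[OF x(1)] False by metis+
  then have "0 < snd (x l)" by (auto simp: star_def)
  then have "\<forall>\<^sub>F z in F. fst (X z l) = fst (x l)" using eventually_same_fst l by blast
  then show ?thesis
    using tendsto_target_off_center[OF l False] by (intro tendsto_if_eventually)
qed

end

section \<open>Continuity on ordered configurations\<close>

lemma height_slide:
  "a \<noteq> 0 \<Longrightarrow> height a (slide \<kappa> c u y) =
    (1 - u) * height a y + u * ((if fst y = a then target c y else 0) / \<kappa>)"
  by (auto simp: height_def slide_def star_pt_def)

definition slide_conf :: "nat \<Rightarrow> real \<Rightarrow> real \<times> (nat \<Rightarrow> star_point) \<Rightarrow> nat \<Rightarrow> star_point" where
  "slide_conf k \<kappa> = (\<lambda>(u, x). \<lambda>l\<in>{..<k}. slide \<kappa> (x ` {..<k}) u (x l))"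

lemma image_slide_conf: "slide_conf k \<kappa> (u, x) ` {..<k} = slide \<kappa> (x ` {..<k}) u ` x ` {..<k}"
  by (simp add: slide_conf_def image_image)

lemma topspace_ordered_conf_star:
  "0 < \<kappa> \<Longrightarrow> topspace (ordered_conf (star_topology n \<kappa>) k) = {x \<in> {..<k} \<rightarrow>\<^sub>E star n. inj_on x {..<k}}"
  by (simp add: topspace_ordered_conf topspace_star_topology)

lemma slide_conf_in_topspace:
  assumes \<kappa>: "0 < \<kappa>" "real k - 1 \<le> \<kappa>" and k: "1 \<le> k" and u: "0 \<le> u" "u \<le> 1"
    and x: "x ` {..<k} \<subseteq> star n" "inj_on x {..<k}"
  shows "slide_conf k \<kappa> (u, x) \<in> topspace (ordered_conf (star_topology n \<kappa>) k)"
proof -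
  let ?c = "x ` {..<k}"
  have c: "?c \<subseteq> star n" "finite ?c" "?c \<noteq> {}" using x k by (auto simp: lessThan_empty_iff)
  have "card ?c = k" using x(2) by (simp add: card_image)
  then have "slide \<kappa> ?c u (x l) \<in> star n" if "l < k" for l
    using slide_in_star[OF c \<kappa>(1) _ u] \<kappa>(2) that by simp
  moreover have "inj_on (\<lambda>l. slide \<kappa> ?c u (x l)) {..<k}"
    using comp_inj_on[OF x(2) slide_inj_on[OF c \<kappa>(1) u]] by (simp add: o_def)
  then have "inj_on (slide_conf k \<kappa> (u, x)) {..<k}"
    by (simp add: slide_conf_def inj_on_def)
  ultimately show ?thesis
    unfolding topspace_ordered_conf_star[OF \<kappa>(1)] by (auto simp: slide_conf_def)
qed

lemma continuous_map_slide_conf: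
  assumes \<kappa>: "0 < \<kappa>" "real k - 1 \<le> \<kappa>" and k: "1 \<le> k"
  shows "continuous_map (prod_topology (top_of_set {0..1}) (ordered_conf (star_topology n \<kappa>) k))
    (ordered_conf (star_topology n \<kappa>) k) (slide_conf k \<kappa>)"
proof -
  let ?S = "star_topology n \<kappa>"
  let ?O = "ordered_conf ?S k"
  let ?Z = "prod_topology (top_of_set {0..1::real}) ?O"
  have topO: "x \<in> topspace ?O \<longleftrightarrow> x \<in> {..<k} \<rightarrow>\<^sub>E star n \<and> inj_on x {..<k}" for x
    by (simp add: topspace_ordered_conf_star[OF \<kappa>(1)])
  have conf: "snd z ` {..<k} \<subseteq> star n \<and> inj_on (snd z) {..<k}" "fst z \<in> {0..1}" if "z \<in> topspace ?Z" for z
    using that by (auto simp: topO)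
  have into: "slide_conf k \<kappa> z \<in> topspace ?O" if "z \<in> topspace ?Z" for z
    using slide_conf_in_topspace[OF \<kappa> k, of "fst z" "snd z" n] conf[OF that] by simp
  have proj: "continuous_map ?Z ?S (\<lambda>z. snd z l)" if "l < k" for l
  proof -
    have "continuous_map ?O ?S (\<lambda>x. x l)"
      unfolding ordered_conf_def using that
      by (intro continuous_map_from_subtopology continuous_map_product_projection) simp
    then show ?thesis
      using continuous_map_compose[OF continuous_map_snd] by (force simp: o_def)
  qed
  have "continuous_map ?Z ?S (\<lambda>z. slide \<kappa> (snd z ` {..<k}) (fst z) (snd z l))" if l: "l < k" for l
    unfolding continuous_map_atin
  proof
    fix z0 assume z0: "z0 \<in> topspace ?Z"
    let ?F = "atin ?Z z0"
    have evZ: "\<forall>\<^sub>F z in ?F. z \<in> topspace ?Z"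
      by (auto simp: eventually_atin intro!: exI[of _ "topspace ?Z"] z0)
    have heights: "((\<lambda>z. height a (snd z l)) \<longlongrightarrow> height a (snd z0 l)) ?F" if "l < k" "a \<in> {1..n}" for l a
      using proj[OF that(1)] z0 that(2) unfolding continuous_map_atin limitin_star[OF \<kappa>(1)] by blast
    have time: "(fst \<longlongrightarrow> fst z0) ?F"
    proof -
      have "continuous_map ?Z euclideanreal fst"
        using continuous_map_fst[of "top_of_set {0..1::real}" ?O] continuous_map_in_subtopology by blast
      then show ?thesis using z0 unfolding continuous_map_atin limitin_canonical_iff by blast
    qed
    have X: "\<forall>\<^sub>F z in ?F. snd z ` {..<k} \<subseteq> star n \<and> inj_on (snd z) {..<k}"
      using evZ by eventually_elim (rule conf(1))
    note x0 = conf(1)[OF z0]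
    have in_star: "slide \<kappa> (snd z ` {..<k}) (fst z) (snd z l) \<in> star n" if "z \<in> topspace ?Z" for z
    proof -
      have "slide_conf k \<kappa> z l \<in> star n" using into[OF that] l by (auto simp: topO)
      then show ?thesis using l by (simp add: slide_conf_def case_prod_beta)
    qed
    show "limitin ?S (\<lambda>z. slide \<kappa> (snd z ` {..<k}) (fst z) (snd z l))
        (slide \<kappa> (snd z0 ` {..<k}) (fst z0) (snd z0 l)) ?F"
      unfolding limitin_star[OF \<kappa>(1)]
    proof (intro conjI ballI)
      show "slide \<kappa> (snd z0 ` {..<k}) (fst z0) (snd z0 l) \<in> star n" using in_star[OF z0] .
      show "\<forall>\<^sub>F z in ?F. slide \<kappa> (snd z ` {..<k}) (fst z) (snd z l) \<in> star n"
        using evZ by eventually_elim (rule in_star)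
      fix a assume a: "a \<in> {1..n}"
      then have a0: "a \<noteq> 0" by simp
      show "((\<lambda>z. height a (slide \<kappa> (snd z ` {..<k}) (fst z) (snd z l)))
          \<longlongrightarrow> height a (slide \<kappa> (snd z0 ` {..<k}) (fst z0) (snd z0 l))) ?F"
        unfolding height_slide[OF a0] using \<kappa>(1)
        by (intro tendsto_add tendsto_mult tendsto_diff tendsto_divide tendsto_const time heights l a
            tendsto_target[OF X conjunct1[OF x0] conjunct2[OF x0]]) auto
    qed
  qed
  then have "continuous_map ?Z ?S (\<lambda>z. slide_conf k \<kappa> z l)" if "l < k" for l
    using that by (simp add: slide_conf_def case_prod_beta)
  moreover have "slide_conf k \<kappa> ` topspace ?Z \<subseteq> extensional {..<k}"
    by (auto simp: slide_conf_def)
  ultimately have "continuous_map ?Z (product_topology (\<lambda>_. ?S) {..<k}) (slide_conf k \<kappa>)"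
    by (auto simp: continuous_map_componentwise)
  moreover have "topspace ?O = topspace (product_topology (\<lambda>_. ?S) {..<k}) \<inter> (({..<k} \<rightarrow>\<^sub>E topspace ?S) - fat_diagonal ?S k)"
    by (simp add: ordered_conf_def)
  then have "slide_conf k \<kappa> \<in> topspace ?Z \<rightarrow> ({..<k} \<rightarrow>\<^sub>E topspace ?S) - fat_diagonal ?S k"
    using into by blast
  ultimately show ?thesis
    \<comment> \<open>This instance rewrites the codomain only; \<open>ordered_conf\<close> also
      occurs in the domain, where it must stay folded.\<close>
    unfolding ordered_conf_def[of ?S k, THEN arg_cong[where f = "\<lambda>Y. continuous_map ?Z Y (slide_conf k \<kappa>)"]]
      continuous_map_in_subtopology by blast
qed

section \<open>Descent to unordered configurations and the retraction\<close>

lemma topspace_star_conf: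
  "0 < \<kappa> \<Longrightarrow> topspace (star_conf n \<kappa> k) = {c. c \<subseteq> star n \<and> finite c \<and> card c = k}"
  by (simp add: star_conf_def topspace_unordered_conf topspace_star_topology)

lemma continuous_map_slide:
  assumes \<kappa>: "0 < \<kappa>" "real k - 1 \<le> \<kappa>" and k: "1 \<le> k"
  shows "continuous_map (prod_topology (top_of_set {0..1}) (star_conf n \<kappa> k)) (star_conf n \<kappa> k)
    (\<lambda>(u, c). slide \<kappa> c u ` c)"
proof -
  let ?O = "ordered_conf (star_topology n \<kappa>) k"
  let ?U = "star_conf n \<kappa> k"
  let ?I = "top_of_set {0..1::real}"
  let ?q = "\<lambda>x::nat \<Rightarrow> star_point. x ` {..<k}"
  have q: "quotient_map ?O ?U ?q"
    unfolding star_conf_def unordered_conf_def by (rule quotient_map_quotient_topology)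
  have I: "locally_compact_space ?I" "Hausdorff_space ?I"
    by (simp_all add: compact_imp_locally_compact_space compact_space_subtopology Hausdorff_space_subtopology)
  \<comment> \<open>The product of a quotient map with the locally compact Hausdorff space
    \<open>{0..1}\<close> is again a quotient map, so continuity can be tested on ordered
    configurations.\<close>
  have qI: "quotient_map (prod_topology ?I ?O) (prod_topology ?I ?U) (\<lambda>(u, x). (u, ?q x))"
    using quotient_map_prod_right[OF I(1) _ q] I(2) by blast
  have "continuous_map (prod_topology ?I ?O) ?U (?q \<circ> slide_conf k \<kappa>)"
    using continuous_map_slide_conf[OF \<kappa> k] quotient_imp_continuous_map[OF q] by (rule continuous_map_compose)
  moreover have "?q \<circ> slide_conf k \<kappa> = (\<lambda>(u, c). slide \<kappa> c u ` c) \<circ> (\<lambda>(u, x). (u, ?q x))"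
    by (simp add: fun_eq_iff image_slide_conf)
  ultimately show ?thesis
    by (intro continuous_compose_quotient_map[OF qI]) (simp only:)
qed

theorem theorem2:
  fixes n k :: nat and \<kappa> :: real
  assumes "2 \<le> n" and "1 \<le> k"
    and "0 < \<kappa>" and "real k - 1 \<le> \<kappa>"
  shows "is_deformation_retract_of (regular_conf n \<kappa> k) (star_conf n \<kappa> k)"
proof -
  let ?U = "star_conf n \<kappa> k"
  let ?D = "regular_conf n \<kappa> k"
  let ?h = "\<lambda>(u, c). slide \<kappa> c u ` c"
  define r where "r = (\<lambda>c. slide \<kappa> c 1 ` c)"
  have sub: "?D \<subseteq> topspace ?U" by (auto simp: regular_conf_def)
  have cont: "continuous_map (prod_topology (top_of_set {0..1}) ?U) ?U ?h"
    using assms by (intro continuous_map_slide)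
  have zero: "slide \<kappa> c 0 ` c = c" if "c \<in> topspace ?U" for c
  proof -
    have "slide \<kappa> c 0 y = y" if "y \<in> c" for y
      using that \<open>c \<in> topspace ?U\<close> star_pt_self[of y n]
      by (auto simp: slide_def topspace_star_conf[OF assms(3)])
    then show ?thesis by simp
  qed
  have fixed: "slide \<kappa> c u ` c = c" if "c \<in> ?D" for c u
  proof -
    have "c \<subseteq> star n" "finite c" "regular n \<kappa> c"
      using that by (auto simp: regular_conf_def topspace_star_conf[OF assms(3)])
    then show ?thesis using slide_fixes_regular[OF assms(3)] by simp
  qed
  have hom: "homotopic_with (\<lambda>f. \<forall>a\<in>?D. f a = a) ?U ?U id r"
  proof (subst homotopic_with)
    \<comment> \<open>The characterisation of \<open>homotopic_with\<close> needs a property that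
      depends only on values on \<open>topspace ?U\<close>; this holds because \<open>?D\<close>
      lies in it.\<close>
    show "(\<forall>a\<in>?D. f a = a) \<longleftrightarrow> (\<forall>a\<in>?D. g a = a)" if "\<And>c. c \<in> topspace ?U \<Longrightarrow> f c = g c" for f g
      using that sub by (metis subsetD)
    show "\<exists>h. continuous_map (prod_topology (top_of_set {0..1::real}) ?U) ?U h \<and>
        (\<forall>c\<in>topspace ?U. h (0, c) = id c) \<and> (\<forall>c\<in>topspace ?U. h (1, c) = r c) \<and>
        (\<forall>t\<in>{0..1::real}. \<forall>a\<in>?D. h (t, a) = a)"
      by (rule exI[of _ ?h]) (simp add: cont zero fixed r_def)
  qed
  have "r c \<in> ?D" if "c \<in> topspace ?U" for c
  proof -
    have c: "c \<subseteq> star n" "finite c" "card c = k" using that by (auto simp: topspace_star_conf[OF assms(3)])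
    then have "regular n \<kappa> (r c)"
      unfolding r_def using assms by (intro slide_one_regular) auto
    moreover have "r c \<in> topspace ?U"
      using homotopic_with_imp_continuous_maps[OF hom] that continuous_map_image_subset_topspace by blast
    ultimately show ?thesis by (simp add: regular_conf_def)
  qed
  then have "continuous_map ?U (subtopology ?U ?D) r"
    using homotopic_with_imp_continuous_maps[OF hom] by (auto simp: continuous_map_in_subtopology)
  moreover have "r a = a" if "a \<in> ?D" for a using fixed[OF that] by (simp add: r_def)
  ultimately have "retraction_maps ?U (subtopology ?U ?D) r id"
    by (simp add: retraction_maps_def continuous_map_from_subtopology)
  then show ?thesis
    unfolding is_deformation_retract_of_def using sub hom by blast
qed

end
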